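(* Let $k$ be a power of $2$ and $n\ge1$. Let $\Pi$ be the transcript of any randomized blackboard protocol for $k$-GUESS on input distribution $\psi_n$ with success probability at least $1/4+c$ for a constant $c>0$. Then $I(B;\Pi\mid D,M)=\Omega(n/k)$ (the constant depending on $c$), where information is measured with respect to $\psi_n$.
   Context: Distribution $\psi_n$: each of $k$ sites holds $n$ bits; $B_{i,\ell}$ is site $i$'s bit in coordinate $\ell$, $B=(B_{i,\ell})$. For each coordinate $\ell\in[n]$ pick $D_\ell$ uniformly from $[k]$; site $D_\ell$ gets a uniform random bit in coordinate $\ell$, all other sites $0$. Then pick $M$ uniformly from $[n]$ and replace coordinate $M$: with probability $1/2$ all of the first $k/2$ sites get $0$ there, otherwise all get $1$; independently the same for the last $k/2$ sites. $D=(D_1,\dots,D_n)$. $X=1$ iff the first $k/2$ sites all have $1$ in coordinate $M$ (else $0$); $Y=1$ iff the last $k/2$ sites all have $1$ in coordinate $M$. $k$-GUESS: the $k$ sites communicate in the blackboard model (every message seen by all) on input $B$; an additional predictor receives $(D,M)$, cannot communicate, and after the communication outputs $g(\Pi(B),D,M)$, where $g$ is the maximum-likelihood function (outputting the value of $(X,Y)$ of maximum conditional probability given the transcript and $(D,M)$). Success means the predictor's output equals $(X,Y)$. The transcript $\Pi$ consists of the sites' messages only. *)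

theory Defs
  imports "HOL-Probability.Probability"
begin

text \<open>
  Sites and coordinates are numbered from 0. An input is the list of the \<open>k\<close> rows held by the sites,
  so \<open>B ! i ! l\<close> is the bit of site \<open>i\<close> in coordinate \<open>l\<close>. All random variables take values in
  countable types, so that \<open>count_space UNIV\<close> is the right measurable space for each of them,
  products included.
\<close>

type_synonym input = "bool list list"

definition base_input :: "nat \<Rightarrow> nat \<Rightarrow> nat list \<Rightarrow> bool list \<Rightarrow> input" where
  "base_input k n D U = map (\<lambda>i. map (\<lambda>l. D ! l = i \<and> U ! l) [0..<n]) [0..<k]"

definition plant :: "nat \<Rightarrow> nat \<Rightarrow> bool \<Rightarrow> bool \<Rightarrow> input \<Rightarrow> input" where
  "plant k m x y B = map (\<lambda>i. (B ! i)[m := (if i < k div 2 then x else y)]) [0..<k]"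

text \<open>The joint law of \<open>(B, D, M)\<close>.\<close>

definition psi :: "nat \<Rightarrow> nat \<Rightarrow> (input \<times> nat list \<times> nat) pmf" where
  "psi k n = do {
     D \<leftarrow> replicate_pmf n (pmf_of_set {..<k});
     U \<leftarrow> replicate_pmf n (bernoulli_pmf (1/2));
     M \<leftarrow> pmf_of_set {..<n};
     x \<leftarrow> bernoulli_pmf (1/2);
     y \<leftarrow> bernoulli_pmf (1/2);
     return_pmf (plant k M x y (base_input k n D U), D, M)
   }"

definition X_val :: "nat \<Rightarrow> input \<Rightarrow> nat \<Rightarrow> bool" where
  "X_val k B m \<longleftrightarrow> (\<forall>i<k div 2. B ! i ! m)"

definition Y_val :: "nat \<Rightarrow> input \<Rightarrow> nat \<Rightarrow> bool" where
  "Y_val k B m \<longleftrightarrow> (\<forall>i\<in>{k div 2..<k}. B ! i ! m)"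

text \<open>
  Private-coin blackboard protocols as binary trees. At \<open>Speak i f P0 P1\<close> site \<open>i\<close> writes the bit
  \<open>f b r\<close>, where \<open>b\<close> is its own row and \<open>r\<close> its own private random string (coded as a natural
  number); the protocol continues with \<open>P0\<close> or \<open>P1\<close> according to that bit. The dependence of the
  speaker and of the message on the blackboard is the dependence on the node. The coins of different
  sites are independent of each other and of the input; their laws are arbitrary, which loses no
  generality as a site has only finitely many deterministic strategies in a finite tree.
\<close>

datatype protocol =
    Halt
  | Speak nat "bool list \<Rightarrow> nat \<Rightarrow> bool" protocol protocol

primrec speakers :: "protocol \<Rightarrow> nat set" where
  "speakers Halt = {}"
| "speakers (Speak i f P0 P1) = insert i (speakers P0 \<union> speakers P1)"

primrec transcript :: "protocol \<Rightarrow> input \<Rightarrow> (nat \<Rightarrow> nat) \<Rightarrow> bool list" where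
  "transcript Halt B R = []"
| "transcript (Speak i f P0 P1) B R =
     (if f (B ! i) (R i) then True # transcript P1 B R else False # transcript P0 B R)"

type_synonym outcome = "input \<times> nat list \<times> nat \<times> bool list"

text \<open>The joint law of \<open>(B, D, M, \<Pi>)\<close>; site \<open>i\<close> draws its private coins from \<open>coins i\<close>.\<close>

definition execution :: "nat \<Rightarrow> nat \<Rightarrow> (nat \<Rightarrow> nat pmf) \<Rightarrow> protocol \<Rightarrow> outcome pmf" where
  "execution k n coins P = do {
     (B, D, M) \<leftarrow> psi k n;
     R \<leftarrow> Pi_pmf {..<k} 0 coins;
     return_pmf (B, D, M, transcript P B R)
   }"

definition B_of :: "outcome \<Rightarrow> input" where "B_of = (\<lambda>(B, D, M, t). B)"
definition D_of :: "outcome \<Rightarrow> nat list" where "D_of = (\<lambda>(B, D, M, t). D)"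
definition M_of :: "outcome \<Rightarrow> nat" where "M_of = (\<lambda>(B, D, M, t). M)"
definition Pi_of :: "outcome \<Rightarrow> bool list" where "Pi_of = (\<lambda>(B, D, M, t). t)"

definition XY_of :: "nat \<Rightarrow> outcome \<Rightarrow> bool \<times> bool" where
  "XY_of k \<omega> = (X_val k (B_of \<omega>) (M_of \<omega>), Y_val k (B_of \<omega>) (M_of \<omega>))"

type_synonym predictor = "bool list \<Rightarrow> nat list \<Rightarrow> nat \<Rightarrow> bool \<times> bool"

definition max_likelihood ::
  "nat \<Rightarrow> nat \<Rightarrow> (nat \<Rightarrow> nat pmf) \<Rightarrow> protocol \<Rightarrow> predictor \<Rightarrow> bool" where
  "max_likelihood k n coins P g \<longleftrightarrow>
     (\<forall>t d m v.
        \<P>(\<omega> in measure_pmf (execution k n coins P).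
            XY_of k \<omega> = v \<bar> Pi_of \<omega> = t \<and> D_of \<omega> = d \<and> M_of \<omega> = m)
      \<le> \<P>(\<omega> in measure_pmf (execution k n coins P).
            XY_of k \<omega> = g t d m \<bar> Pi_of \<omega> = t \<and> D_of \<omega> = d \<and> M_of \<omega> = m))"

definition success_prob ::
  "nat \<Rightarrow> nat \<Rightarrow> (nat \<Rightarrow> nat pmf) \<Rightarrow> protocol \<Rightarrow> predictor \<Rightarrow> real" where
  "success_prob k n coins P g =
     \<P>(\<omega> in measure_pmf (execution k n coins P). g (Pi_of \<omega>) (D_of \<omega>) (M_of \<omega>) = XY_of k \<omega>)"

text \<open>\<open>I(B; \<Pi> | D, M)\<close> in bits.\<close>

definition info_cost :: "nat \<Rightarrow> nat \<Rightarrow> (nat \<Rightarrow> nat pmf) \<Rightarrow> protocol \<Rightarrow> real" where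
  "info_cost k n coins P =
     prob_space.conditional_mutual_information (measure_pmf (execution k n coins P)) 2
       (count_space UNIV) (count_space UNIV) (count_space UNIV)
       B_of Pi_of (\<lambda>\<omega>. (D_of \<omega>, M_of \<omega>))"

end

theory Submission
  imports Defs
begin

text \<open>
  Condition on \<open>D\<close>, \<open>M = m\<close> and \<open>X = Y = 0\<close>, an event of conditional probability \<open>1/4\<close>. By the chain rule
  the information cost is at least a quarter of the sum over \<open>l \<noteq> m\<close> of the information the transcript
  reveals about coordinate \<open>l\<close>, and this is, up to a constant, the average over the owner \<open>i\<close> of the
  coordinate of the squared Hellinger distance between the transcript laws for \<open>0\<close> and for the unit
  vector \<open>e\<^sub>i\<close> in coordinate \<open>l\<close>. Since transcript probabilities are products over the sites, the sum
  over \<open>i\<close> of these distances controls the distance between the laws for \<open>0\<close> and for the indicator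
  of any set of \<open>2\<^sup>j\<close> sites (Jayram), in particular for the four planted patterns. These laws must be
  distinguishable if the predictor succeeds when \<open>M = l\<close>.

  The two situations differ in that coordinate \<open>m\<close> has been set to zero. For random \<open>m\<close> this changes the
  success probability by \<open>O(1 / sqrt n)\<close>, which is harmless for \<open>n\<close> large in terms of \<open>c\<close>. For
  smaller \<open>n\<close> the information about \<open>(X, Y)\<close> alone is at least \<open>c\<^sup>2\<close>.
\<close>

subsection \<open>Set functions with small average on pairs of blocks\<close>

lemma ex_permutes_image_eq:
  assumes "finite S" "A \<subseteq> S" "B \<subseteq> S" "card A = card B"
  obtains \<sigma> where "\<sigma> permutes S" "\<sigma> ` A = B"
proof -
  have fin: "finite A" "finite B" using assms finite_subset by blast+
  have "card (S - A) = card (S - B)"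
    using assms fin by (simp add: card_Diff_subset)
  then obtain f g where f: "bij_betw f A B" and g: "bij_betw g (S - A) (S - B)"
    using assms fin by (metis finite_same_card_bij finite_Diff)
  define \<sigma> where "\<sigma> x = (if x \<in> A then f x else if x \<in> S then g x else x)" for x
  have A: "bij_betw \<sigma> A B"
    using f by (rule bij_betw_cong[THEN iffD1, rotated]) (auto simp: \<sigma>_def)
  have "bij_betw \<sigma> (S - A) (S - B)"
    using g by (rule bij_betw_cong[THEN iffD1, rotated]) (auto simp: \<sigma>_def)
  then have "bij_betw \<sigma> (A \<union> (S - A)) (B \<union> (S - B))"
    using A by (intro bij_betw_combine) auto
  moreover have "A \<union> (S - A) = S" "B \<union> (S - B) = S" using assms by auto
  ultimately have "\<sigma> permutes S"
    using assms by (intro bij_imp_permutes) (auto simp: \<sigma>_def)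
  moreover have "\<sigma> ` A = B" using A by (simp add: bij_betw_def)
  ultimately show ?thesis by (rule that)
qed

text \<open>Replacing \<open>\<pi>\<close> by \<open>\<pi> \<circ> \<sigma>\<close>, with
  \<open>\<sigma>\<close> carrying \<open>A\<close> to \<open>B\<close>, only reorders the summands.
  So a symmetrised set function depends on cardinality alone.\<close>

lemma sum_permutes_image_cong:
  fixes \<delta> :: "'a set \<Rightarrow> real"
  assumes "finite S" "A \<subseteq> S" "B \<subseteq> S" "card A = card B"
  shows "(\<Sum>\<pi> | \<pi> permutes S. \<delta> (\<pi> ` A)) = (\<Sum>\<pi> | \<pi> permutes S. \<delta> (\<pi> ` B))"
proof -
  obtain \<sigma> where \<sigma>: "\<sigma> permutes S" "\<sigma> ` A = B"
    using ex_permutes_image_eq[OF assms] by blast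
  have "(\<Sum>\<pi> | \<pi> permutes S. \<delta> (\<pi> ` A)) = (\<Sum>\<pi> | \<pi> permutes S. \<delta> ((\<pi> \<circ> \<sigma>) ` A))"
    by (rule sum_permutations_compose_right[OF \<sigma>(1)])
  then show ?thesis using \<sigma>(2) by (simp only: image_comp[symmetric])
qed

text \<open>The bound 1/4 alone is not inductive, since every factor is below 1. The extra term
  absorbs the next factor; the bound is exact at \<open>m = 1\<close>.\<close>

lemma prod_one_minus_half_powers_ge:
  "(\<Prod>i=1..m. 1 - (1/2::real) ^ i) \<ge> 1/4 + (1/2) ^ (m + 1)" if "m \<ge> 1"
  using that
proof (induction m rule: dec_induct)
  case base
  show ?case by (simp add: power2_eq_square)
next
  case (step m)
  define x :: real where "x = (1/2) ^ m"
  have x: "0 \<le> x" "x \<le> 1/2"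
    using step.hyps power_decreasing[of 1 m "1/2::real"] by (auto simp: x_def)
  have "(1/4 + x/2) * (1 - x/2) \<le> (\<Prod>i=1..m. 1 - (1/2::real) ^ i) * (1 - x/2)"
    using step.IH x by (intro mult_right_mono) (auto simp: x_def)
  moreover have "x * x \<le> x * (1/2)" using x by (intro mult_left_mono) auto
  then have "1/4 + x/4 \<le> (1/4 + x/2) * (1 - x/2)"
    by (simp add: algebra_simps)
  ultimately show ?case by (simp add: x_def)
qed

text \<open>Averaging the hypothesis over all permutations of \<open>S\<close> makes the average of \<open>\<delta>\<close> over
  the subsets of size \<open>2s\<close> at most \<open>2r / (r - 1)\<close> times the average over the subsets of
  size \<open>s\<close>, where \<open>r = card S / s\<close>; the product of the factors \<open>r / (r - 1)\<close> over
  \<open>r = 2, 4, 8, \<dots>\<close> is at most \<open>4\<close>.\<close>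

lemma doubling_bound:
  fixes \<delta> :: "'a set \<Rightarrow> real"
  assumes fin: "finite S" and card: "card S = 2 ^ J" and nonneg: "\<And>A. A \<subseteq> S \<Longrightarrow> \<delta> A \<ge> 0"
    and pairs: "\<And>r (A :: nat \<Rightarrow> 'a set). (\<And>a. a < r \<Longrightarrow> A a \<subseteq> S) \<Longrightarrow> disjoint_family_on A {..<r} \<Longrightarrow>
      (\<Sum>a<r. \<Sum>b\<in>{..<r}-{a}. \<delta> (A a \<union> A b)) \<le> 2 * real r * (\<Sum>a<r. \<delta> (A a))"
  shows "\<delta> S \<le> 4 * (\<Sum>i\<in>S. \<delta> {i})"
proof -
  obtain e where e: "bij_betw e {..<(2::nat)^J} S"
    using ex_bij_betw_nat_finite[OF fin] card by (auto simp: lessThan_atLeast0)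
  have einj: "inj_on e {..<2^J}" and eimg: "e ` {..<2^J} = S"
    using e by (auto simp: bij_betw_def)
  \<comment> \<open>For \<open>s\<close> at most \<open>2^J\<close> this is
    \<open>fact (2^J)\<close> times the average of \<open>\<delta>\<close> over the subsets of size
    \<open>s\<close>.\<close>
  define T where "T s = (\<Sum>\<pi> | \<pi> permutes S. \<delta> (\<pi> ` e ` {..<s}))" for s
  define p where "p m = (\<Prod>i=1..m. 1 - (1/2::real) ^ i)" for m
  have T_eq: "(\<Sum>\<pi> | \<pi> permutes S. \<delta> (\<pi> ` e ` X)) = T s"
    if "X \<subseteq> {..<2^J}" "card X = s" for X s
    unfolding T_def
  proof (rule sum_permutes_image_cong[OF fin])
    have "s \<le> 2^J" using that card_mono[of "{..<2^J}" X] by simp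
    then have sub: "{..<s} \<subseteq> {..<2^J}" by auto
    show "e ` X \<subseteq> S" "e ` {..<s} \<subseteq> S" using image_mono[OF sub, of e] image_mono[OF that(1), of e] eimg by simp_all
    show "card (e ` X) = card (e ` {..<s})"
      using card_image[OF inj_on_subset[OF einj sub]] card_image[OF inj_on_subset[OF einj that(1)]] that
      by simp
  qed
  \<comment> \<open>\<open>S\<close> is cut into \<open>r\<close> blocks of size \<open>s\<close>.
    Each of the \<open>r * (r - 1)\<close> ordered pairs contributes \<open>T (2 * s)\<close>, each
    block \<open>T s\<close>; then one factor \<open>r\<close> cancels.\<close>
  have step: "(real r - 1) * T (2 * s) \<le> 2 * real r * T s" if rs: "r * s = 2 ^ J" and "r \<ge> 2" for r s
  proof -
    define blk where "blk a = {a * s..<a * s + s}" for a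
    have blk_sub: "blk a \<subseteq> {..<2^J}" if "a < r" for a
    proof -
      have "a * s + s = (a + 1) * s" by simp
      also have "\<dots> \<le> r * s" using that by (intro mult_right_mono) auto
      finally show ?thesis using rs by (auto simp: blk_def)
    qed
    have blk_disj: "blk a \<inter> blk b = {}" if "a \<noteq> b" for a b
    proof -
      have "blk a \<inter> blk b = {}" if "a < b" for a b
      proof -
        have "(a + 1) * s \<le> b * s" using that by (intro mult_right_mono) auto
        then show ?thesis by (auto simp: blk_def)
      qed
      then show ?thesis using that by (metis Int_commute nat_neq_iff)
    qed
    have blk_card: "card (blk a) = s" for a by (simp add: blk_def)
    have blk_card2: "card (blk a \<union> blk b) = 2 * s" if "a \<noteq> b" for a b
      using blk_disj[OF that] by (subst card_Un_disjoint) (auto simp: blk_card, auto simp: blk_def)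
    have main: "(\<Sum>a<r. \<Sum>b\<in>{..<r}-{a}. \<delta> (\<pi> ` e ` (blk a \<union> blk b))) \<le> 2 * real r * (\<Sum>a<r. \<delta> (\<pi> ` e ` blk a))"
      if \<pi>: "\<pi> permutes S" for \<pi>
    proof -
      have inj: "inj_on (\<lambda>x. \<pi> (e x)) {..<2^J}"
        using comp_inj_on[OF einj inj_on_subset[OF permutes_inj[OF \<pi>] subset_UNIV]] by (simp add: comp_def)
      have "(\<Sum>a<r. \<Sum>b\<in>{..<r}-{a}. \<delta> (\<pi> ` e ` blk a \<union> \<pi> ` e ` blk b)) \<le> 2 * real r * (\<Sum>a<r. \<delta> (\<pi> ` e ` blk a))"
      proof (rule pairs)
        fix a assume "a < r"
        then have "e ` blk a \<subseteq> S" using blk_sub eimg by blast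
        then show "\<pi> ` e ` blk a \<subseteq> S" using permutes_image[OF \<pi>] by blast
      next
        show "disjoint_family_on (\<lambda>a. \<pi> ` e ` blk a) {..<r}"
          unfolding disjoint_family_on_def image_image
          using inj_on_image_Int[OF inj blk_sub blk_sub] blk_disj by (metis image_empty lessThan_iff)
      qed
      then show ?thesis by (simp add: image_Un)
    qed
    have "(\<Sum>a<r. \<Sum>b\<in>{..<r}-{a}. T (2 * s)) =
        (\<Sum>a<r. \<Sum>b\<in>{..<r}-{a}. \<Sum>\<pi> | \<pi> permutes S. \<delta> (\<pi> ` e ` (blk a \<union> blk b)))"
      using blk_sub by (intro sum.cong refl T_eq[symmetric] blk_card2) auto
    also have "\<dots> = (\<Sum>\<pi> | \<pi> permutes S. \<Sum>a<r. \<Sum>b\<in>{..<r}-{a}. \<delta> (\<pi> ` e ` (blk a \<union> blk b)))"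
      by (simp add: sum.swap[where B = "{\<pi>. \<pi> permutes S}"])
    also have "\<dots> \<le> (\<Sum>\<pi> | \<pi> permutes S. 2 * real r * (\<Sum>a<r. \<delta> (\<pi> ` e ` blk a)))"
      using main by (intro sum_mono) auto
    also have "\<dots> = 2 * real r * (\<Sum>a<r. \<Sum>\<pi> | \<pi> permutes S. \<delta> (\<pi> ` e ` blk a))"
      by (simp add: sum_distrib_left sum.swap[where A = "{\<pi>. \<pi> permutes S}"])
    also have "\<dots> = 2 * real r * (\<Sum>a<r. T s)"
      using blk_sub by (intro arg_cong2[where f = "(*)"] refl sum.cong T_eq blk_card) auto
    finally have "real r * ((real r - 1) * T (2 * s)) \<le> real r * (2 * real r * T s)"
      using \<open>r \<ge> 2\<close> by (simp add: of_nat_diff algebra_simps)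
    then show ?thesis using \<open>r \<ge> 2\<close> by (simp add: mult_le_cancel_left)
  qed
  have Tpos: "T 1 \<ge> 0"
    unfolding T_def
  proof (intro sum_nonneg nonneg)
    fix \<pi> assume "\<pi> \<in> {\<pi>. \<pi> permutes S}"
    moreover have "e ` {..<1} \<subseteq> S" using eimg by auto
    ultimately show "\<pi> ` e ` {..<1} \<subseteq> S" using permutes_image[of \<pi> S] by blast
  qed
  \<comment> \<open>After \<open>j\<close> doublings the factors of \<open>p J\<close> with index
    above \<open>J - j\<close> have been used up. Keeping the products on both sides avoids
    division.\<close>
  have bound: "T (2^j) * p J \<le> 2^j * p (J - j) * T 1" if "j \<le> J" for j
    using that
  proof (induction j)
    case 0
    then show ?case by (simp add: mult.commute)
  next
    case (Suc j)
    define r where "r = (2::nat) ^ (J - j)"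
    have r2: "r \<ge> 2" using Suc.prems self_le_power[of 2 "J - j"] by (simp add: r_def)
    have rs: "r * 2^j = 2^J" using Suc.prems by (simp add: r_def flip: power_add)
    have Jj: "J - j = Suc (J - Suc j)" using Suc.prems by simp
    have pr: "p (J - j) = p (J - Suc j) * ((real r - 1) / real r)"
      by (simp add: p_def Jj r_def field_simps power_divide)
    have ppos: "p J \<ge> 0" unfolding p_def by (intro prod_nonneg) (auto simp: power_le_one)
    have "(real r - 1) * (T (2 ^ Suc j) * p J) \<le> 2 * real r * (T (2^j) * p J)"
      using mult_right_mono[OF step[OF rs r2] ppos] by (simp add: algebra_simps)
    also have "\<dots> \<le> 2 * real r * (2^j * p (J - j) * T 1)"
      using Suc by (intro mult_left_mono) auto
    also have "\<dots> = (real r - 1) * (2 ^ Suc j * p (J - Suc j) * T 1)"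
      using r2 by (simp add: pr field_simps)
    finally show ?case using r2 by (simp add: mult_le_cancel_left)
  qed
  have "p J \<ge> 1/4"
  proof (cases "J = 0")
    case False
    moreover have "(1/2::real)^(J+1) \<ge> 0" by simp
    ultimately show ?thesis using prod_one_minus_half_powers_ge[of J] unfolding p_def by linarith
  qed (simp add: p_def)
  have perm_S: "T (2^J) = fact (2^J) * \<delta> S"
  proof -
    have "T (2^J) = (\<Sum>\<pi> | \<pi> permutes S. \<delta> S)"
      unfolding T_def eimg by (intro sum.cong refl) (auto simp: permutes_image)
    then show ?thesis using card_permutations[OF card fin] by simp
  qed
  have perm_1: "2^J * T 1 = fact (2^J) * (\<Sum>i\<in>S. \<delta> {i})"
  proof -
    have "2^J * T 1 = (\<Sum>x<2^J. \<Sum>\<pi> | \<pi> permutes S. \<delta> (\<pi> ` e ` {x}))"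
      by (subst sum.cong[OF refl T_eq[where s = 1]]) auto
    also have "\<dots> = (\<Sum>x\<in>S. \<Sum>\<pi> | \<pi> permutes S. \<delta> {\<pi> x})"
      using sum.reindex_bij_betw[OF e, of "\<lambda>x. \<Sum>\<pi> | \<pi> permutes S. \<delta> {\<pi> x}"] by simp
    also have "\<dots> = (\<Sum>\<pi> | \<pi> permutes S. \<Sum>x\<in>S. \<delta> {\<pi> x})" by (rule sum.swap)
    also have "\<dots> = (\<Sum>\<pi> | \<pi> permutes S. \<Sum>x\<in>S. \<delta> {x})"
      by (intro sum.cong refl sum.reindex_bij_betw[where g = "\<lambda>x. \<delta> {x}"]) (auto dest: permutes_imp_bij)
    finally show ?thesis using card_permutations[OF card fin] by simp
  qed
  have "fact (2^J) * \<delta> S * (1/4) \<le> T (2^J) * p J"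
    unfolding perm_S using \<open>p J \<ge> 1/4\<close> nonneg[of S] by (intro mult_left_mono) auto
  also have "\<dots> \<le> 2^J * T 1" using bound[of J] by (simp add: p_def)
  finally show ?thesis unfolding perm_1 by simp
qed

subsection \<open>Averages over words\<close>

text \<open>\<open>psi\<close> is built from uniform choices, so conditional expectations become
  nested finite averages. On an empty set the value is 0.\<close>

definition avg :: "'a set \<Rightarrow> ('a \<Rightarrow> real) \<Rightarrow> real" where
  "avg S f = (\<Sum>x\<in>S. f x) / card S"

definition words :: "'a set \<Rightarrow> nat \<Rightarrow> 'a list set" where
  "words A n = {xs. set xs \<subseteq> A \<and> length xs = n}"

lemma avg_cong: "(\<And>x. x \<in> S \<Longrightarrow> f x = g x) \<Longrightarrow> avg S f = avg S g"
  by (simp add: avg_def cong: sum.cong)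

lemma avg_mono: "(\<And>x. x \<in> S \<Longrightarrow> f x \<le> g x) \<Longrightarrow> avg S f \<le> avg S g"
  by (simp add: avg_def divide_right_mono sum_mono)

lemma avg_nonneg: "(\<And>x. x \<in> S \<Longrightarrow> 0 \<le> f x) \<Longrightarrow> 0 \<le> avg S f"
  by (simp add: avg_def sum_nonneg)

lemma avg_const: "finite S \<Longrightarrow> S \<noteq> {} \<Longrightarrow> avg S (\<lambda>_. c) = c"
  by (simp add: avg_def)

lemma avg_add: "avg S (\<lambda>x. f x + g x) = avg S f + avg S g"
  by (simp add: avg_def sum.distrib add_divide_distrib)

lemma avg_diff: "avg S (\<lambda>x. f x - g x) = avg S f - avg S g"
  by (simp add: avg_def sum_subtractf diff_divide_distrib)

lemma avg_cmult: "avg S (\<lambda>x. c * f x) = c * avg S f"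
  by (simp add: avg_def sum_distrib_left)

lemma avg_multc: "avg S (\<lambda>x. f x * c) = avg S f * c"
  by (simp add: avg_def sum_distrib_right)

lemma avg_divide: "avg S (\<lambda>x. f x / c) = avg S f / c"
  by (simp add: avg_def sum_divide_distrib[symmetric])

lemma avg_sum: "avg S (\<lambda>x. \<Sum>i\<in>I. f x i) = (\<Sum>i\<in>I. avg S (\<lambda>x. f x i))"
  unfolding avg_def by (subst sum.swap) (simp add: sum_divide_distrib)

lemma avg_swap: "avg S (\<lambda>x. avg T (\<lambda>y. f x y)) = avg T (\<lambda>y. avg S (\<lambda>x. f x y))"
  unfolding avg_def
  by (subst (2) sum_divide_distrib[symmetric], subst (1) sum_divide_distrib[symmetric], subst sum.swap) simp

lemma avg_UNIV_bool: "avg UNIV f = (f True + f False) / 2"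
  by (simp add: avg_def UNIV_bool)

lemma avg_pos:
  assumes "finite S" "x \<in> S" "f x > 0" "\<And>y. y \<in> S \<Longrightarrow> f y \<ge> 0"
  shows "avg S f > 0"
  unfolding avg_def
  using assms by (intro divide_pos_pos sum_pos2[of S x]) (auto simp: card_gt_0_iff)

lemma finite_words: "finite A \<Longrightarrow> finite (words A n)"
  unfolding words_def by (rule finite_lists_length_eq)

lemma words_nonempty: "A \<noteq> {} \<Longrightarrow> words A n \<noteq> {}"
proof -
  assume "A \<noteq> {}"
  then obtain a where "a \<in> A" by blast
  then have "replicate n a \<in> words A n" by (auto simp: words_def)
  then show ?thesis by blast
qed

lemma card_words: "finite A \<Longrightarrow> card (words A n) = card A ^ n"
  unfolding words_def by (rule card_lists_length_eq)

lemma words_0: "words A 0 = {[]}"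
  by (auto simp: words_def)

lemma words_Suc: "words A (Suc n) = (\<lambda>(x, xs). x # xs) ` (A \<times> words A n)"
  by (auto simp: words_def length_Suc_conv image_iff)

lemma avg_words_Suc:
  assumes "finite A"
  shows "avg (words A (Suc n)) f = avg A (\<lambda>x. avg (words A n) (\<lambda>xs. f (x # xs)))"
proof -
  have inj: "inj_on (\<lambda>(x, xs). x # xs) (A \<times> words A n)" by (auto simp: inj_on_def)
  have "(\<Sum>xs\<in>words A (Suc n). f xs) = (\<Sum>x\<in>A. \<Sum>xs\<in>words A n. f (x # xs))"
    unfolding words_Suc by (subst sum.reindex[OF inj]) (simp add: sum.cartesian_product split_beta)
  then show ?thesis
    unfolding avg_def by (simp add: card_words assms sum_divide_distrib[symmetric])
qed

text \<open>A coordinate of a uniform word is uniform and independent of the others. Redrawing it is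
  how a single bit or owner is singled out below.\<close>

lemma avg_words_update:
  assumes "finite A" "A \<noteq> {}" "l < n"
  shows "avg (words A n) f = avg (words A n) (\<lambda>u. avg A (\<lambda>b. f (u[l := b])))"
  using assms(3)
proof (induction n arbitrary: l f)
  case (Suc n)
  note IH = Suc.IH and prems = Suc.prems
  show ?case
  proof (cases l)
    case 0
    show ?thesis
      using assms(1,2) by (simp add: avg_words_Suc 0 avg_const) (rule avg_swap)
  next
    case (Suc l')
    then have "l' < n" using prems by simp
    then have "avg (words A n) (\<lambda>xs. f (x # xs)) = avg (words A n) (\<lambda>xs. avg A (\<lambda>b. f (x # xs[l' := b])))" for x
      by (rule IH)
    then show ?thesis
      using assms(1) Suc by (simp add: avg_words_Suc)
  qed
qed simp

lemma avg_words_prod: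
  assumes "finite A"
  shows "avg (words A n) (\<lambda>u. \<Prod>l<n. \<phi> l (u ! l)) = (\<Prod>l<n. avg A (\<phi> l))"
proof (induction n arbitrary: \<phi>)
  case 0
  show ?case by (simp add: words_0 avg_def)
next
  case (Suc n)
  show ?case
    using assms Suc[of "\<lambda>l. \<phi> (Suc l)"]
    by (simp add: avg_words_Suc prod.lessThan_Suc_shift avg_cmult avg_multc del: prod.lessThan_Suc)
qed

text \<open>Coordinate \<open>l\<close> of \<open>u\<close> is visible in the row of site \<open>d ! l\<close> only, so the rows are
  independent.\<close>

lemma avg_words_prod_rows:
  fixes G :: "nat \<Rightarrow> bool list \<Rightarrow> real"
  assumes "finite I"
  shows "avg (words UNIV (length d)) (\<lambda>u. \<Prod>i\<in>I. G i (map2 (\<lambda>a b. a = i \<and> b) d u)) =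
    (\<Prod>i\<in>I. avg (words UNIV (length d)) (\<lambda>u. G i (map2 (\<lambda>a b. a = i \<and> b) d u)))"
proof (induction d arbitrary: G)
  case Nil
  show ?case by (simp add: words_0 avg_def)
next
  case (Cons a d)
  define H where "H i b = avg (words UNIV (length d)) (\<lambda>u. G i (b # map2 (\<lambda>a b. a = i \<and> b) d u))" for i b
  have "avg (words UNIV (length (a # d))) (\<lambda>u. \<Prod>i\<in>I. G i (map2 (\<lambda>a b. a = i \<and> b) (a # d) u)) =
     avg UNIV (\<lambda>b. \<Prod>i\<in>I. H i (a = i \<and> b))"
    using Cons[of "\<lambda>i r. G i ((a = i \<and> _) # r)"] by (simp add: avg_words_Suc H_def)
  \<comment> \<open>Only the factor of the owner \<open>a\<close> depends on the new bit
    \<open>b\<close>, so the average over \<open>b\<close> moves into that factor.\<close>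
  also have "\<dots> = (\<Prod>i\<in>I. avg UNIV (\<lambda>b. H i (a = i \<and> b)))"
  proof (cases "a \<in> I")
    case True
    have "(\<Prod>i\<in>I-{a}. H i (a = i \<and> b)) = (\<Prod>i\<in>I-{a}. H i False)"
         "(\<Prod>i\<in>I-{a}. avg UNIV (\<lambda>b. H i (a = i \<and> b))) = (\<Prod>i\<in>I-{a}. H i False)" for b
      by (auto intro!: prod.cong simp: avg_UNIV_bool)
    then show ?thesis
      using True assms by (simp add: prod.remove[where x = a] avg_multc)
  next
    case False
    then have "a \<noteq> i" if "i \<in> I" for i using that by blast
    then have "(\<Prod>i\<in>I. H i (a = i \<and> b)) = (\<Prod>i\<in>I. H i False)"
         "(\<Prod>i\<in>I. avg UNIV (\<lambda>b. H i (a = i \<and> b))) = (\<Prod>i\<in>I. H i False)" for b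
      by (simp_all add: avg_UNIV_bool)
    then show ?thesis by (simp add: avg_const)
  qed
  finally show ?case by (simp add: avg_words_Suc H_def)
qed

lemma replicate_pmf_of_set:
  assumes "finite A" "A \<noteq> {}"
  shows "replicate_pmf n (pmf_of_set A) = pmf_of_set (words A n)"
proof (induction n)
  case 0
  show ?case by (simp add: words_0 pmf_of_set_singleton)
next
  case (Suc n)
  have inj: "inj_on (\<lambda>(x, xs). x # xs) (A \<times> words A n)" by (auto simp: inj_on_def)
  have "replicate_pmf (Suc n) (pmf_of_set A) =
      map_pmf (\<lambda>(x, xs). x # xs) (pair_pmf (pmf_of_set A) (pmf_of_set (words A n)))"
    by (simp add: Suc pair_pmf_def map_bind_pmf)
  also have "pair_pmf (pmf_of_set A) (pmf_of_set (words A n)) = pmf_of_set (A \<times> words A n)"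
    using assms
    by (intro pmf_eqI, unfold split_paired_all)
      (simp add: pmf_pair finite_words words_nonempty card_cartesian_product indicator_def)
  also have "map_pmf (\<lambda>(x, xs). x # xs) \<dots> = pmf_of_set (words A (Suc n))"
    unfolding words_Suc using assms by (intro map_pmf_of_set_inj inj) (auto simp: words_nonempty finite_words)
  finally show ?case .
qed

subsection \<open>Hellinger distance and information\<close>

text \<open>The squared Hellinger distance, without the usual factor 1/2.\<close>

definition hell :: "'t set \<Rightarrow> ('t \<Rightarrow> real) \<Rightarrow> ('t \<Rightarrow> real) \<Rightarrow> real" where
  "hell T f g = (\<Sum>t\<in>T. (sqrt (f t) - sqrt (g t))\<^sup>2)"

lemma hell_nonneg: "hell T f g \<ge> 0"
  by (simp add: hell_def sum_nonneg)

text \<open>Recentred at \<open>z\<close>, the full double sum is \<open>2 * r\<close> times the sum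
  of squares minus twice the square of the sum. Applied pointwise, this supplies the hypothesis on
  pairs in \<open>doubling_bound\<close>.\<close>

lemma sum_pairwise_diff_squares_le:
  fixes x :: "nat \<Rightarrow> real"
  shows "(\<Sum>a<r. \<Sum>b\<in>{..<r}-{a}. (x a - x b)\<^sup>2) \<le> 2 * real r * (\<Sum>a<r. (z - x a)\<^sup>2)"
proof -
  define y where "y a = z - x a" for a
  have "(\<Sum>a<r. \<Sum>b\<in>{..<r}-{a}. (x a - x b)\<^sup>2) \<le> (\<Sum>a<r. \<Sum>b<r. (x a - x b)\<^sup>2)"
    by (intro sum_mono sum_mono2) auto
  also have "\<dots> = (\<Sum>a<r. \<Sum>b<r. (y a)\<^sup>2 + (y b)\<^sup>2 - 2 * y a * y b)"
    by (intro sum.cong refl) (simp add: y_def power2_eq_square algebra_simps)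
  also have "\<dots> = 2 * real r * (\<Sum>a<r. (y a)\<^sup>2) - 2 * (\<Sum>a<r. y a)\<^sup>2"
    by (simp add: sum.distrib sum_subtractf sum_distrib_left[symmetric] sum_distrib_right[symmetric]
        power2_eq_square mult.assoc)
  also have "\<dots> \<le> 2 * real r * (\<Sum>a<r. (y a)\<^sup>2)" by simp
  finally show ?thesis by (simp add: y_def)
qed

text \<open>For disjoint \<open>A\<close> and \<open>B\<close> the cut-and-paste identity \<open>F A * F B = F {} * F (A \<union> B)\<close> shows that
  \<open>F A\<close>, \<open>F B\<close> are as far apart as \<open>F {}\<close>, \<open>F (A \<union> B)\<close>.\<close>

lemma hell_product_le_sum:
  fixes W :: "'i \<Rightarrow> 't \<Rightarrow> bool \<Rightarrow> real" and I :: "'i set"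
  defines "F \<equiv> \<lambda>A t. \<Prod>i\<in>I. W i t (i \<in> A)"
  assumes I: "finite I" and W: "\<And>i t b. W i t b \<ge> 0" and one: "\<And>A. A \<subseteq> I \<Longrightarrow> (\<Sum>t\<in>T. F A t) = 1"
    and S: "S \<subseteq> I" "card S = 2 ^ J"
  shows "hell T (F {}) (F S) \<le> 4 * (\<Sum>i\<in>S. hell T (F {}) (F {i}))"
proof (rule doubling_bound)
  show "finite S" using I S finite_subset by blast
  show "card S = 2 ^ J" by fact
  show "0 \<le> hell T (F {}) (F A)" for A by (rule hell_nonneg)
next
  fix r and A :: "nat \<Rightarrow> 'i set"
  assume sub: "\<And>a. a < r \<Longrightarrow> A a \<subseteq> S" and disj: "disjoint_family_on A {..<r}"
  have F0: "F X t \<ge> 0" for X t unfolding F_def using W by (intro prod_nonneg) auto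
  \<comment> \<open>The distance depends on the two laws only through the pointwise product
    \<open>F X t * F Y t\<close>, which cut-and-paste preserves.\<close>
  have hell_eq: "hell T (F X) (F Y) = 2 - 2 * (\<Sum>t\<in>T. sqrt (F X t * F Y t))" if "X \<subseteq> I" "Y \<subseteq> I" for X Y
  proof -
    have "hell T (F X) (F Y) = (\<Sum>t\<in>T. F X t + F Y t - 2 * sqrt (F X t * F Y t))"
      unfolding hell_def by (intro sum.cong refl) (simp add: power2_diff F0 real_sqrt_mult)
    then show ?thesis using one that by (simp add: sum.distrib sum_subtractf sum_distrib_left)
  qed
  have paste: "hell T (F {}) (F (X \<union> Y)) = hell T (F X) (F Y)" if "X \<subseteq> I" "Y \<subseteq> I" "X \<inter> Y = {}" for X Y
  proof -
    have "F X t * F Y t = F {} t * F (X \<union> Y) t" for t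
      unfolding F_def prod.distrib[symmetric]
    proof (intro prod.cong refl)
      fix i
      show "W i t (i \<in> X) * W i t (i \<in> Y) = W i t (i \<in> {}) * W i t (i \<in> X \<union> Y)"
        using that(3) by (cases "i \<in> X"; cases "i \<in> Y") auto
    qed
    then show ?thesis using that by (simp add: hell_eq)
  qed
  have "(\<Sum>a<r. \<Sum>b\<in>{..<r}-{a}. hell T (F {}) (F (A a \<union> A b))) =
      (\<Sum>a<r. \<Sum>b\<in>{..<r}-{a}. hell T (F (A a)) (F (A b)))"
    using sub S disj by (intro sum.cong refl paste) (auto simp: disjoint_family_on_def)
  also have "\<dots> = (\<Sum>t\<in>T. \<Sum>a<r. \<Sum>b\<in>{..<r}-{a}. (sqrt (F (A a) t) - sqrt (F (A b) t))\<^sup>2)"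
    unfolding hell_def by (simp add: sum.swap[where B = T])
  also have "\<dots> \<le> (\<Sum>t\<in>T. 2 * real r * (\<Sum>a<r. (sqrt (F {} t) - sqrt (F (A a) t))\<^sup>2))"
    by (intro sum_mono sum_pairwise_diff_squares_le)
  also have "\<dots> = 2 * real r * (\<Sum>a<r. hell T (F {}) (F (A a)))"
    unfolding hell_def by (simp add: sum_distrib_left sum.swap[where A = T])
  finally show "(\<Sum>a<r. \<Sum>b\<in>{..<r}-{a}. hell T (F {}) (F (A a \<union> A b))) \<le>
      2 * real r * (\<Sum>a<r. hell T (F {}) (F (A a)))" .
qed

text \<open>The total variation distance is at most the Hellinger distance; the square root is linearised
  by \<open>2x \<le> \<lambda> + x\<^sup>2 / \<lambda>\<close>.\<close>

lemma distinguish_le_hell: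
  assumes f: "\<And>t. f t \<ge> 0" "(\<Sum>t\<in>T. f t) = 1" and g: "\<And>t. g t \<ge> 0" "(\<Sum>t\<in>T. g t) = 1"
    and w: "\<And>t. 0 \<le> w t" "\<And>t. w t \<le> 1" and lam: "lam > 0"
  shows "2 * (\<Sum>t\<in>T. (f t - g t) * w t) \<le> lam + hell T f g / lam"
proof -
  \<comment> \<open>Factor \<open>f t - g t\<close> as a difference of squares and apply weighted
    AM-GM to the two factors.\<close>
  have pt: "2 * \<bar>f t - g t\<bar> \<le> lam / 2 * (sqrt (f t) + sqrt (g t))\<^sup>2 + 2 / lam * (sqrt (f t) - sqrt (g t))\<^sup>2" for t
  proof -
    define x y where "x = \<bar>sqrt (f t) - sqrt (g t)\<bar>" and "y = sqrt (f t) + sqrt (g t)"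
    have "f t - g t = (sqrt (f t) - sqrt (g t)) * y"
      using f(1)[of t] g(1)[of t] by (simp add: y_def algebra_simps)
    moreover have "y \<ge> 0" using f(1)[of t] g(1)[of t] by (simp add: y_def)
    ultimately have "\<bar>f t - g t\<bar> = x * y" by (simp add: x_def abs_mult)
    moreover have "0 \<le> (sqrt (lam / 2) * y - sqrt (2 / lam) * x)\<^sup>2" by simp
    then have "2 * (y * x) \<le> lam / 2 * y\<^sup>2 + 2 / lam * x\<^sup>2"
      using lam by (simp add: power2_diff power_mult_distrib real_sqrt_divide power_divide)
    moreover have "x\<^sup>2 = (sqrt (f t) - sqrt (g t))\<^sup>2" by (simp add: x_def)
    moreover have "y * x = x * y" by (rule mult.commute)
    ultimately show ?thesis unfolding y_def by simp
  qed
  have sq: "(sqrt (f t) + sqrt (g t))\<^sup>2 \<le> 2 * f t + 2 * g t" for t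
  proof -
    have "0 \<le> (sqrt (f t) - sqrt (g t))\<^sup>2" by simp
    then show ?thesis using f(1)[of t] g(1)[of t] by (simp add: power2_diff power2_sum)
  qed
  \<comment> \<open>Both laws have mass 1, so \<open>2 * w t\<close> may be replaced by
    \<open>2 * w t - 1\<close>, which has modulus at most 1. This gains a factor 2 over using
    \<open>w t \<le> 1\<close>.\<close>
  have "2 * ((f t - g t) * (2 * w t)) \<le> 2 * ((f t - g t) + \<bar>f t - g t\<bar>)" for t
  proof -
    have "(f t - g t) * (2 * w t - 1) \<le> \<bar>f t - g t\<bar> * \<bar>2 * w t - 1\<bar>"
      by (metis abs_ge_self abs_mult)
    also have "\<dots> \<le> \<bar>f t - g t\<bar> * 1" using w[of t] by (intro mult_left_mono) auto
    finally have "(f t - g t) * (2 * w t - 1) \<le> \<bar>f t - g t\<bar> * 1" .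
    then show ?thesis by (simp add: algebra_simps)
  qed
  then have "4 * (\<Sum>t\<in>T. (f t - g t) * w t) \<le> (\<Sum>t\<in>T. 2 * ((f t - g t) + \<bar>f t - g t\<bar>))"
    unfolding sum_distrib_left by (intro sum_mono) (simp add: algebra_simps)
  also have "\<dots> = (\<Sum>t\<in>T. 2 * \<bar>f t - g t\<bar>)"
    using f(2) g(2) unfolding distrib_left sum.distrib right_diff_distrib sum_subtractf sum_distrib_left[symmetric]
    by simp
  also have "\<dots> \<le> (\<Sum>t\<in>T. lam / 2 * (2 * f t + 2 * g t) + 2 / lam * (sqrt (f t) - sqrt (g t))\<^sup>2)"
  proof (rule sum_mono)
    fix t
    have "lam / 2 * (sqrt (f t) + sqrt (g t))\<^sup>2 \<le> lam / 2 * (2 * f t + 2 * g t)"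
      using lam by (intro mult_left_mono sq) simp
    with pt[of t] show "2 * \<bar>f t - g t\<bar> \<le> lam / 2 * (2 * f t + 2 * g t) + 2 / lam * (sqrt (f t) - sqrt (g t))\<^sup>2"
      by linarith
  qed
  also have "\<dots> = 2 * lam + 2 * (hell T f g / lam)"
    using f(2) g(2) unfolding hell_def sum.distrib sum_distrib_left[symmetric] by simp
  finally show ?thesis by simp
qed

text \<open>This is \<open>ln x \<le> x - 1\<close> at \<open>x = sqrt (h / f)\<close>. Summed over
  laws of equal mass the term \<open>f - h\<close> cancels, so relative entropy dominates the
  Hellinger distance.\<close>

lemma mult_ln_div_ge:
  assumes "f \<ge> 0" "h \<ge> 0" "f > 0 \<Longrightarrow> h > 0"
  shows "f * ln (f / h) \<ge> (sqrt f - sqrt h)\<^sup>2 + f - h"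
proof (cases "f = 0")
  case True
  then show ?thesis using assms by simp
next
  case False
  with assms have pos: "f > 0" "h > 0" by auto
  have "ln (sqrt (h / f)) \<le> sqrt (h / f) - 1" using pos by (intro ln_le_minus_one) simp
  then have "f * (2 - 2 * sqrt (h / f)) \<le> f * (- 2 * ln (sqrt (h / f)))"
    using pos by (intro mult_left_mono) auto
  also have "- 2 * ln (sqrt (h / f)) = ln (f / h)" using pos by (simp add: ln_sqrt ln_div)
  also have "f * (2 - 2 * sqrt (h / f)) = (sqrt f - sqrt h)\<^sup>2 + f - h"
  proof -
    have "f * sqrt (h / f) = sqrt f * sqrt h"
      using pos by (simp add: real_sqrt_divide field_simps)
    then show ?thesis using pos by (simp add: power2_diff algebra_simps)
  qed
  finally show ?thesis .
qed

text \<open>Superadditivity of information over independent bits, for the likelihoods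
  \<open>\<phi>\<close> of one fixed transcript. They are compared with a product of one-bit
  averages, and each bit is bounded separately. As \<open>\<phi>\<close> is not normalised, its mass
  \<open>\<mu>\<close> appears throughout.\<close>

lemma gibbs_avg_words:
  fixes \<phi> :: "bool list \<Rightarrow> real" and n :: nat
  defines "U \<equiv> words UNIV n"
  assumes \<phi>: "\<And>u. \<phi> u \<ge> 0"
  defines "\<mu> \<equiv> avg U \<phi>" and "\<nu> \<equiv> \<lambda>l b. avg U (\<lambda>u. \<phi> (u[l := b]))"
  shows "avg U (\<lambda>u. \<phi> u * ln (\<phi> u / \<mu>)) \<ge> (\<Sum>l<n. (sqrt (\<nu> l False) - sqrt (\<nu> l True))\<^sup>2) / 4"
proof -
  have U: "finite U" "U \<noteq> {}" unfolding U_def by (simp_all add: finite_words words_nonempty)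
  have \<nu>0: "\<nu> l b \<ge> 0" for l b unfolding \<nu>_def using \<phi> by (intro avg_nonneg) auto
  have \<mu>0: "\<mu> \<ge> 0" unfolding \<mu>_def using \<phi> by (intro avg_nonneg) auto
  have avg_upd: "avg U g = avg UNIV (\<lambda>b. avg U (\<lambda>u. g (u[l := b])))" if "l < n" for g :: "bool list \<Rightarrow> real" and l
    unfolding U_def using that by (subst avg_words_update[of _ l]) (auto intro: avg_swap)
  have \<mu>\<nu>: "(\<nu> l True + \<nu> l False) / 2 = \<mu>" if "l < n" for l
    unfolding \<mu>_def \<nu>_def by (subst (3) avg_upd[OF that]) (simp add: avg_UNIV_bool)
  show ?thesis
  proof (cases "\<mu> = 0")
    case True
    then have \<nu>z: "\<nu> l b = 0" if "l < n" for l b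
      using \<mu>\<nu>[OF that] \<nu>0[of l True] \<nu>0[of l False] by (cases b) auto
    have "\<phi> u = 0" if "u \<in> U" for u
      using avg_pos[of U u \<phi>] \<phi> U that True by (force simp: \<mu>_def less_le)
    then have "avg U (\<lambda>u. \<phi> u * ln (\<phi> u / \<mu>)) = 0"
      using U by (subst avg_cong[of _ _ "\<lambda>_. 0"]) (auto simp: avg_const)
    then show ?thesis by (simp add: \<nu>z)
  next
    case False
    then have \<mu>pos: "\<mu> > 0" using \<mu>0 by simp
    \<comment> \<open>The product density with the same mass and the same one-bit averages
      \<open>\<nu>\<close> as \<open>\<phi>\<close>.\<close>
    define h where "h u = \<mu> * (\<Prod>l<n. \<nu> l (u ! l) / \<mu>)" for u
    have h0: "h u \<ge> 0" for u unfolding h_def using \<nu>0 \<mu>0 by (intro mult_nonneg_nonneg prod_nonneg) auto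
    have \<nu>pos: "\<nu> l (u ! l) > 0" if "u \<in> U" "\<phi> u > 0" "l < n" for u l
      unfolding \<nu>_def using that U \<phi> by (intro avg_pos[of U u]) auto
    have hpos: "h u > 0" if "u \<in> U" "\<phi> u > 0" for u
      unfolding h_def using that \<nu>pos \<mu>pos by (intro mult_pos_pos prod_pos) auto
    have "avg U h = \<mu> * (\<Prod>l<n. avg UNIV (\<lambda>b. \<nu> l b / \<mu>))"
      unfolding h_def U_def avg_cmult by (subst avg_words_prod) simp_all
    also have "(\<Prod>l<n. avg UNIV (\<lambda>b. \<nu> l b / \<mu>)) = 1"
    proof (rule prod.neutral, safe)
      fix l assume "l < n"
      then show "avg UNIV (\<lambda>b. \<nu> l b / \<mu>) = 1"
        using \<mu>\<nu>[of l] \<mu>pos by (simp add: avg_UNIV_bool add_divide_distrib[symmetric])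
    qed
    finally have avg_h: "avg U h = \<mu>" by simp
    have "0 = avg U (\<lambda>u. \<phi> u - h u)" unfolding avg_diff avg_h by (simp add: \<mu>_def)
    also have "\<dots> \<le> avg U (\<lambda>u. \<phi> u * ln (\<phi> u / h u))"
    proof (rule avg_mono)
      fix u assume "u \<in> U"
      then have "\<phi> u * ln (\<phi> u / h u) \<ge> (sqrt (\<phi> u) - sqrt (h u))\<^sup>2 + \<phi> u - h u"
        using \<phi> h0 hpos by (intro mult_ln_div_ge) auto
      moreover have "(sqrt (\<phi> u) - sqrt (h u))\<^sup>2 \<ge> 0" by simp
      ultimately show "\<phi> u - h u \<le> \<phi> u * ln (\<phi> u / h u)" by linarith
    qed
    finally have gibbs: "0 \<le> avg U (\<lambda>u. \<phi> u * ln (\<phi> u / h u))" .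
    \<comment> \<open>The logarithm of \<open>h\<close> is a sum over coordinates. What remains is
      the divergence from \<open>h\<close>, nonnegative by \<open>gibbs\<close>.\<close>
    have split: "\<phi> u * ln (\<phi> u / \<mu>) = \<phi> u * ln (\<phi> u / h u) + (\<Sum>l<n. \<phi> u * ln (\<nu> l (u ! l) / \<mu>))"
      if "u \<in> U" for u
    proof (cases "\<phi> u = 0")
      case False
      then have pos: "\<phi> u > 0" using \<phi>[of u] by simp
      have "ln (h u) = ln \<mu> + ln (\<Prod>l<n. \<nu> l (u ! l) / \<mu>)"
        unfolding h_def using pos that \<nu>pos \<mu>pos by (intro ln_mult_pos prod_pos) auto
      also have "ln (\<Prod>l<n. \<nu> l (u ! l) / \<mu>) = (\<Sum>l<n. ln (\<nu> l (u ! l) / \<mu>))"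
      proof (intro ln_prod)
        fix l assume "l \<in> {..<n}"
        then have "\<nu> l (u ! l) > 0" using \<nu>pos[OF that pos] by simp
        then show "\<nu> l (u ! l) / \<mu> \<noteq> 0" using \<mu>pos by simp
      qed simp
      finally have "ln (h u) = ln \<mu> + (\<Sum>l<n. ln (\<nu> l (u ! l) / \<mu>))" .
      then have "ln (\<phi> u / \<mu>) = ln (\<phi> u / h u) + (\<Sum>l<n. ln (\<nu> l (u ! l) / \<mu>))"
        using pos hpos[OF that pos] \<mu>pos by (simp add: ln_div)
      then show ?thesis by (simp add: distrib_left sum_distrib_left)
    qed simp
    have coord: "avg U (\<lambda>u. \<phi> u * ln (\<nu> l (u ! l) / \<mu>)) \<ge> (sqrt (\<nu> l False) - sqrt (\<nu> l True))\<^sup>2 / 4"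
      if l: "l < n" for l
    proof -
      have "avg U (\<lambda>u. \<phi> u * ln (\<nu> l (u ! l) / \<mu>)) = avg UNIV (\<lambda>b. avg U (\<lambda>u. \<phi> (u[l := b]) * ln (\<nu> l (u[l := b] ! l) / \<mu>)))"
        by (rule avg_upd[OF l])
      also have "\<dots> = avg UNIV (\<lambda>b. \<nu> l b * ln (\<nu> l b / \<mu>))"
      proof (rule avg_cong)
        fix b
        have "avg U (\<lambda>u. \<phi> (u[l := b]) * ln (\<nu> l (u[l := b] ! l) / \<mu>)) = avg U (\<lambda>u. \<phi> (u[l := b]) * ln (\<nu> l b / \<mu>))"
          using l by (intro avg_cong) (auto simp: U_def words_def)
        then show "avg U (\<lambda>u. \<phi> (u[l := b]) * ln (\<nu> l (u[l := b] ! l) / \<mu>)) = \<nu> l b * ln (\<nu> l b / \<mu>)"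
          by (simp add: avg_multc \<nu>_def)
      qed
      also have "\<dots> \<ge> avg UNIV (\<lambda>b. (sqrt (\<nu> l b) - sqrt \<mu>)\<^sup>2 + \<nu> l b - \<mu>)"
        using \<nu>0 \<mu>pos by (intro avg_mono mult_ln_div_ge) auto
      moreover have "avg UNIV (\<lambda>b. (sqrt (\<nu> l b) - sqrt \<mu>)\<^sup>2 + \<nu> l b - \<mu>) \<ge>
          (sqrt (\<nu> l False) - sqrt (\<nu> l True))\<^sup>2 / 4"
      proof -
        define x y z where "x = sqrt (\<nu> l True)" and "y = sqrt (\<nu> l False)" and "z = sqrt \<mu>"
        \<comment> \<open>The right-hand side is least when \<open>z\<close> is the midpoint of
          \<open>x\<close> and \<open>y\<close>; hence the factor 1/4.\<close>
        have "(y - x)\<^sup>2 / 4 \<le> ((x - z)\<^sup>2 + (y - z)\<^sup>2) / 2"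
        proof -
          have "((x - z)\<^sup>2 + (y - z)\<^sup>2) / 2 - (y - x)\<^sup>2 / 4 = (x + y - 2 * z)\<^sup>2 / 4"
            by (simp add: power2_eq_square field_simps)
          moreover have "(x + y - 2 * z)\<^sup>2 / 4 \<ge> 0" by simp
          ultimately show ?thesis by linarith
        qed
        moreover have "avg UNIV (\<lambda>b. (sqrt (\<nu> l b) - sqrt \<mu>)\<^sup>2 + \<nu> l b - \<mu>) = ((x - z)\<^sup>2 + (y - z)\<^sup>2) / 2"
        proof -
          have "\<nu> l True + \<nu> l False = 2 * \<mu>" using \<mu>\<nu>[OF l] by simp
          moreover have "(p + a - c + (q + b - c)) / 2 = (p + q) / 2" if "a + b = 2 * c" for a b c p q :: real
            using that by simp
          ultimately show ?thesis unfolding avg_UNIV_bool x_def y_def z_def by blast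
        qed
        ultimately show ?thesis unfolding x_def y_def by linarith
      qed
      ultimately show ?thesis by linarith
    qed
    have "avg U (\<lambda>u. \<phi> u * ln (\<phi> u / \<mu>)) =
        avg U (\<lambda>u. \<phi> u * ln (\<phi> u / h u) + (\<Sum>l<n. \<phi> u * ln (\<nu> l (u ! l) / \<mu>)))"
      using split by (intro avg_cong) auto
    also have "\<dots> = avg U (\<lambda>u. \<phi> u * ln (\<phi> u / h u)) + (\<Sum>l<n. avg U (\<lambda>u. \<phi> u * ln (\<nu> l (u ! l) / \<mu>)))"
      by (simp add: avg_add avg_sum)
    also have "\<dots> \<ge> 0 + (\<Sum>l<n. (sqrt (\<nu> l False) - sqrt (\<nu> l True))\<^sup>2 / 4)"
      using gibbs coord by (intro add_mono sum_mono) auto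
    finally show ?thesis by (simp add: sum_divide_distrib)
  qed
qed

text \<open>The chain rule I(v,u;t) = I(v;t) + I(u;t|v) in nats, for independent uniform
  \<open>v\<close> and \<open>u\<close>. The first two claims each drop one nonnegative term; the
  third later permits restriction to a single \<open>v\<close>.\<close>

lemma information_chain_bounds:
  fixes f :: "'v \<Rightarrow> 'u \<Rightarrow> 't \<Rightarrow> real" and V :: "'v set" and U :: "'u set" and T :: "'t set"
  defines "fv \<equiv> \<lambda>v t. avg U (\<lambda>u. f v u t)"
  defines "F \<equiv> \<lambda>t. avg V (\<lambda>v. fv v t)"
  defines "J \<equiv> avg V (\<lambda>v. avg U (\<lambda>u. \<Sum>t\<in>T. f v u t * ln (f v u t / F t)))"
  assumes V: "finite V" "V \<noteq> {}" and U: "finite U" "U \<noteq> {}"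
    and f0: "\<And>v u t. f v u t \<ge> 0" and f1: "\<And>v u. v \<in> V \<Longrightarrow> u \<in> U \<Longrightarrow> (\<Sum>t\<in>T. f v u t) = 1"
  shows "J \<ge> avg V (\<lambda>v. hell T (fv v) F)"
    and "J \<ge> avg V (\<lambda>v. \<Sum>t\<in>T. avg U (\<lambda>u. f v u t * ln (f v u t / fv v t)))"
    and "v \<in> V \<Longrightarrow> (\<Sum>t\<in>T. avg U (\<lambda>u. f v u t * ln (f v u t / fv v t))) \<ge> 0"
proof -
  have fv0: "fv v t \<ge> 0" for v t unfolding fv_def by (intro avg_nonneg f0)
  have F0: "F t \<ge> 0" for t unfolding F_def by (intro avg_nonneg fv0)
  have fvpos: "fv v t > 0" if "u \<in> U" "f v u t > 0" for v u t
    unfolding fv_def by (rule avg_pos[of U u]) (use that U f0 in auto)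
  have Fpos: "F t > 0" if "v \<in> V" "fv v t > 0" for v t
    unfolding F_def by (rule avg_pos[of V v]) (use that V fv0 in auto)
  have inner: "avg U (\<lambda>u. f v u t * ln (f v u t / fv v t)) \<ge> 0" for v t
  proof -
    have "0 = avg U (\<lambda>u. f v u t - fv v t)" using U by (simp add: avg_diff avg_const fv_def)
    also have "\<dots> \<le> avg U (\<lambda>u. f v u t * ln (f v u t / fv v t))"
    proof (rule avg_mono)
      fix u assume "u \<in> U"
      then have "f v u t * ln (f v u t / fv v t) \<ge> (sqrt (f v u t) - sqrt (fv v t))\<^sup>2 + f v u t - fv v t"
        using f0 fv0 fvpos by (intro mult_ln_div_ge) auto
      moreover have "(sqrt (f v u t) - sqrt (fv v t))\<^sup>2 \<ge> 0" by simp
      ultimately show "f v u t - fv v t \<le> f v u t * ln (f v u t / fv v t)" by linarith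
    qed
    finally show ?thesis .
  qed
  then show "(\<Sum>t\<in>T. avg U (\<lambda>u. f v u t * ln (f v u t / fv v t))) \<ge> 0" if "v \<in> V"
    by (intro sum_nonneg)
  have fv1: "(\<Sum>t\<in>T. fv v t) = 1" if "v \<in> V" for v
    unfolding fv_def avg_sum[symmetric] using that U by (subst avg_cong[OF f1]) (auto simp: avg_const)
  have F1: "(\<Sum>t\<in>T. F t) = 1"
    unfolding F_def avg_sum[symmetric] using V by (subst avg_cong[OF fv1]) (auto simp: avg_const)
  have outer: "(\<Sum>t\<in>T. fv v t * ln (fv v t / F t)) \<ge> hell T (fv v) F" if "v \<in> V" for v
  proof -
    have "(\<Sum>t\<in>T. (sqrt (fv v t) - sqrt (F t))\<^sup>2 + fv v t - F t) \<le> (\<Sum>t\<in>T. fv v t * ln (fv v t / F t))"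
      using fv0 F0 Fpos that by (intro sum_mono mult_ln_div_ge) auto
    then show ?thesis using fv1[OF that] F1 by (simp add: hell_def sum.distrib sum_subtractf)
  qed
  have "J = avg V (\<lambda>v. \<Sum>t\<in>T. avg U (\<lambda>u. f v u t * ln (f v u t / fv v t) + f v u t * ln (fv v t / F t)))"
    unfolding J_def avg_sum
  proof (intro avg_cong sum.cong refl)
    fix v t u assume v: "v \<in> V" "u \<in> U"
    show "f v u t * ln (f v u t / F t) = f v u t * ln (f v u t / fv v t) + f v u t * ln (fv v t / F t)"
    proof (cases "f v u t = 0")
      case False
      then have "f v u t > 0" using f0[of v u t] by simp
      with fvpos[OF v(2) this] Fpos[OF v(1) fvpos[OF v(2) this]] show ?thesis
        by (simp add: ln_div algebra_simps)
    qed simp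
  qed
  also have "\<dots> = avg V (\<lambda>v. \<Sum>t\<in>T. avg U (\<lambda>u. f v u t * ln (f v u t / fv v t))) +
      avg V (\<lambda>v. \<Sum>t\<in>T. fv v t * ln (fv v t / F t))"
    by (simp add: avg_add avg_multc sum.distrib fv_def)
  finally have J: "J = \<dots>" .
  have "avg V (\<lambda>v. \<Sum>t\<in>T. avg U (\<lambda>u. f v u t * ln (f v u t / fv v t))) \<ge> 0"
    by (rule avg_nonneg, rule sum_nonneg, rule inner)
  moreover have "avg V (\<lambda>v. \<Sum>t\<in>T. fv v t * ln (fv v t / F t)) \<ge> avg V (\<lambda>v. hell T (fv v) F)"
    using outer by (rule avg_mono)
  moreover have "avg V (\<lambda>v. hell T (fv v) F) \<ge> 0" by (intro avg_nonneg hell_nonneg)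
  ultimately show "J \<ge> avg V (\<lambda>v. hell T (fv v) F)"
    and "J \<ge> avg V (\<lambda>v. \<Sum>t\<in>T. avg U (\<lambda>u. f v u t * ln (f v u t / fv v t)))"
    unfolding J by linarith+
qed

section \<open>Mutual information of discrete variables as an expectation\<close>

lemma mutual_information_pmf:
  fixes p :: "'o pmf" and X :: "'o \<Rightarrow> 'a::countable" and Y :: "'o \<Rightarrow> 'b::countable"
  assumes b: "b > 1"
  shows "prob_space.mutual_information (measure_pmf p) b (count_space UNIV) (count_space UNIV) X Y =
    measure_pmf.expectation p (\<lambda>\<omega>. log b (pmf (map_pmf (\<lambda>\<omega>. (X \<omega>, Y \<omega>)) p) (X \<omega>, Y \<omega>) /
      (pmf (map_pmf X p) (X \<omega>) * pmf (map_pmf Y p) (Y \<omega>))))"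
proof -
  let ?PX = "map_pmf X p" and ?PY = "map_pmf Y p" and ?PXY = "map_pmf (\<lambda>\<omega>. (X \<omega>, Y \<omega>)) p"
  let ?f = "\<lambda>x. pmf ?PX (fst x) * pmf ?PY (snd x)"
  have cs: "count_space UNIV \<Otimes>\<^sub>M count_space UNIV = (count_space UNIV :: ('a \<times> 'b) measure)"
    by (subst pair_measure_countable) auto
  have ac: "pmf ?PXY x = 0" if "?f x = 0" for x
  proof (rule ccontr)
    assume "pmf ?PXY x \<noteq> 0"
    then have "x \<in> set_pmf ?PXY" by (simp only: set_pmf_iff not_False_eq_True)
    then have "fst x \<in> set_pmf ?PX" "snd x \<in> set_pmf ?PY" by auto
    then have "pmf ?PX (fst x) \<noteq> 0" "pmf ?PY (snd x) \<noteq> 0" by (simp_all only: set_pmf_iff not_False_eq_True)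
    then show False using that by simp
  qed
  have "measure_pmf ?PX \<Otimes>\<^sub>M measure_pmf ?PY =
      density (count_space UNIV) (\<lambda>x. ennreal (pmf ?PX x)) \<Otimes>\<^sub>M density (count_space UNIV) (\<lambda>x. ennreal (pmf ?PY x))"
    by (simp only: measure_pmf_eq_density)
  also have "\<dots> = density (count_space UNIV \<Otimes>\<^sub>M count_space UNIV) (\<lambda>(x, y). ennreal (pmf ?PX x) * ennreal (pmf ?PY y))"
  proof (rule pair_measure_density)
    show "sigma_finite_measure (count_space (UNIV :: 'b set))"
      by (rule sigma_finite_measure_count_space)
    show "sigma_finite_measure (density (count_space UNIV) (\<lambda>x. ennreal (pmf ?PY x)))"
      unfolding measure_pmf_eq_density[symmetric] by (rule prob_space_imp_sigma_finite) (rule measure_pmf.prob_space_axioms)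
  qed auto
  also have "\<dots> = density (count_space UNIV) (\<lambda>x. ennreal (?f x))"
    unfolding cs by (intro density_cong) (auto simp: ennreal_mult)
  finally have prod: "measure_pmf ?PX \<Otimes>\<^sub>M measure_pmf ?PY = density (count_space UNIV) (\<lambda>x. ennreal (?f x))" .
  interpret S: sigma_finite_measure "count_space (UNIV :: ('a \<times> 'b) set)"
    by (rule sigma_finite_measure_count_space)
  have "prob_space.mutual_information (measure_pmf p) b (count_space UNIV) (count_space UNIV) X Y =
      KL_divergence b (measure_pmf ?PX \<Otimes>\<^sub>M measure_pmf ?PY) (measure_pmf ?PXY)"
    by (simp add: prob_space.mutual_information_def[OF measure_pmf.prob_space_axioms] cs map_pmf_rep_eq)
  also have "\<dots> = KL_divergence b (density (count_space UNIV) (\<lambda>x. ennreal (?f x)))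
      (density (count_space UNIV) (\<lambda>x. ennreal (pmf ?PXY x)))"
    unfolding prod by (simp only: measure_pmf_eq_density)
  also have "\<dots> = (\<integral>x. pmf ?PXY x * log b (pmf ?PXY x / ?f x) \<partial>count_space UNIV)"
    using ac b by (intro S.KL_density_density) auto
  also have "\<dots> = (\<integral>x. log b (pmf ?PXY x / ?f x) \<partial>measure_pmf ?PXY)"
    unfolding measure_pmf_eq_density by (subst integral_density) auto
  also have "\<dots> = measure_pmf.expectation p (\<lambda>\<omega>. log b (pmf ?PXY (X \<omega>, Y \<omega>) / (pmf ?PX (X \<omega>) * pmf ?PY (Y \<omega>))))"
    by (subst integral_map_pmf) simp
  finally show ?thesis .
qed

text \<open>By definition this is I(X;(Y,Z)) - I(X;Z). Finite support makes both integrands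
  integrable, so they combine under one integral, where the law of \<open>X\<close> cancels.\<close>

lemma conditional_mutual_information_pmf:
  fixes p :: "'o pmf" and X :: "'o \<Rightarrow> 'a::countable" and Y :: "'o \<Rightarrow> 'b::countable" and Z :: "'o \<Rightarrow> 'c::countable"
  assumes b: "b > 1" and fin: "finite (set_pmf p)"
  shows "prob_space.conditional_mutual_information (measure_pmf p) b
      (count_space UNIV) (count_space UNIV) (count_space UNIV) X Y Z =
    measure_pmf.expectation p (\<lambda>\<omega>. log b
      (pmf (map_pmf (\<lambda>\<omega>. (X \<omega>, Y \<omega>, Z \<omega>)) p) (X \<omega>, Y \<omega>, Z \<omega>) * pmf (map_pmf Z p) (Z \<omega>) /
       (pmf (map_pmf (\<lambda>\<omega>. (X \<omega>, Z \<omega>)) p) (X \<omega>, Z \<omega>) * pmf (map_pmf (\<lambda>\<omega>. (Y \<omega>, Z \<omega>)) p) (Y \<omega>, Z \<omega>))))"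
proof -
  have cs: "count_space UNIV \<Otimes>\<^sub>M count_space UNIV = (count_space UNIV :: ('b \<times> 'c) measure)"
    by (subst pair_measure_countable) auto
  have pos: "pmf (map_pmf g p) (g \<omega>) > 0" if "\<omega> \<in> set_pmf p" for g :: "'o \<Rightarrow> 'd" and \<omega>
    using that by (intro pmf_positive) auto
  note int = integrable_measure_pmf_finite[OF fin]
  show ?thesis
    unfolding prob_space.conditional_mutual_information_def[OF measure_pmf.prob_space_axioms] cs mutual_information_pmf[OF b]
      Bochner_Integration.integral_diff[OF int int, symmetric]
  proof (intro integral_cong_AE AE_pmfI)
    fix \<omega> assume \<omega>: "\<omega> \<in> set_pmf p"
    note ps = pos[OF \<omega>, of X] pos[OF \<omega>, of Z] pos[OF \<omega>, of "\<lambda>\<omega>. (X \<omega>, Z \<omega>)"]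
      pos[OF \<omega>, of "\<lambda>\<omega>. (Y \<omega>, Z \<omega>)"] pos[OF \<omega>, of "\<lambda>\<omega>. (X \<omega>, Y \<omega>, Z \<omega>)"]
    show "log b (pmf (map_pmf (\<lambda>\<omega>. (X \<omega>, Y \<omega>, Z \<omega>)) p) (X \<omega>, Y \<omega>, Z \<omega>) /
       (pmf (map_pmf X p) (X \<omega>) * pmf (map_pmf (\<lambda>\<omega>. (Y \<omega>, Z \<omega>)) p) (Y \<omega>, Z \<omega>))) -
      log b (pmf (map_pmf (\<lambda>\<omega>. (X \<omega>, Z \<omega>)) p) (X \<omega>, Z \<omega>) /
       (pmf (map_pmf X p) (X \<omega>) * pmf (map_pmf Z p) (Z \<omega>))) =
      log b (pmf (map_pmf (\<lambda>\<omega>. (X \<omega>, Y \<omega>, Z \<omega>)) p) (X \<omega>, Y \<omega>, Z \<omega>) * pmf (map_pmf Z p) (Z \<omega>) /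
       (pmf (map_pmf (\<lambda>\<omega>. (X \<omega>, Z \<omega>)) p) (X \<omega>, Z \<omega>) * pmf (map_pmf (\<lambda>\<omega>. (Y \<omega>, Z \<omega>)) p) (Y \<omega>, Z \<omega>)))"
      using ps b by (simp add: log_divide_pos log_mult_pos)
  qed auto
qed

subsection \<open>The law of an execution\<close>

definition transcript_pmf :: "nat \<Rightarrow> (nat \<Rightarrow> nat pmf) \<Rightarrow> protocol \<Rightarrow> input \<Rightarrow> bool list pmf" where
  "transcript_pmf k coins P B = map_pmf (transcript P B) (Pi_pmf {..<k} 0 coins)"

text \<open>A finite set carrying the transcript laws of all inputs at once, so that all sums over
  transcripts share one index set.\<close>

primrec leaves :: "protocol \<Rightarrow> bool list set" where
  "leaves Halt = {[]}"
| "leaves (Speak i f P0 P1) = (#) False ` leaves P0 \<union> (#) True ` leaves P1"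

lemma finite_leaves: "finite (leaves P)"
  by (induction P) auto

lemma transcript_in_leaves: "transcript P B R \<in> leaves P"
  by (induction P) auto

text \<open>The constraint that site \<open>i\<close> alone puts on \<open>t\<close>. Strings that
  are not root-to-leaf paths are rejected whatever the site.\<close>

primrec consistent :: "protocol \<Rightarrow> nat \<Rightarrow> bool list \<Rightarrow> nat \<Rightarrow> bool list \<Rightarrow> bool" where
  "consistent Halt i b r t \<longleftrightarrow> t = []"
| "consistent (Speak j f P0 P1) i b r t \<longleftrightarrow> t \<noteq> [] \<and> (j = i \<longrightarrow> f b r = hd t) \<and>
     (if hd t then consistent P1 i b r (tl t) else consistent P0 i b r (tl t))"

text \<open>The rectangle property of blackboard protocols: each bit constrains only its speaker.
  With \<open>k > 0\<close> the right-hand side is not vacuous for strings that are no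
  transcripts.\<close>

lemma transcript_eq_iff_consistent:
  assumes "k > 0" "speakers P \<subseteq> {..<k}"
  shows "transcript P B R = t \<longleftrightarrow> (\<forall>i<k. consistent P i (B ! i) (R i) t)"
  using assms(2)
proof (induction P arbitrary: t)
  case Halt
  then show ?case using assms(1) by auto
next
  case (Speak j f P0 P1)
  then have j: "j < k" and P: "speakers P0 \<subseteq> {..<k}" "speakers P1 \<subseteq> {..<k}" by auto
  show ?case
  proof (cases t)
    case Nil
    then show ?thesis using assms(1) by auto
  next
    case (Cons x t')
    then show ?thesis using Speak.IH(1)[OF P(1), of t'] Speak.IH(2)[OF P(2), of t'] j by (cases x) auto
  qed
qed

definition weight :: "(nat \<Rightarrow> nat pmf) \<Rightarrow> protocol \<Rightarrow> nat \<Rightarrow> bool list \<Rightarrow> bool list \<Rightarrow> real" where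
  "weight coins P i t b = measure_pmf.prob (coins i) {r. consistent P i b r t}"

text \<open>The coins leading to \<open>t\<close> form a box, and coins of different sites are
  independent. Cut-and-paste rests on this product form.\<close>

lemma pmf_transcript_pmf:
  assumes "k > 0" "speakers P \<subseteq> {..<k}"
  shows "pmf (transcript_pmf k coins P B) t = (\<Prod>i<k. weight coins P i t (B ! i))"
proof -
  have "transcript P B -` {t} = Pi {..<k} (\<lambda>i. {r. consistent P i (B ! i) r t})"
    using transcript_eq_iff_consistent[OF assms, of B] by (auto simp: Pi_def)
  then show ?thesis
    by (simp add: transcript_pmf_def pmf_map measure_Pi_pmf_Pi weight_def)
qed

lemma set_transcript_pmf: "set_pmf (transcript_pmf k coins P B) \<subseteq> leaves P"
  by (auto simp: transcript_pmf_def transcript_in_leaves)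

lemma sum_transcript_pmf: "(\<Sum>t\<in>leaves P. pmf (transcript_pmf k coins P B) t) = 1"
  by (rule sum_pmf_eq_1[OF finite_leaves set_transcript_pmf])

section \<open>Success probability and information cost as averages\<close>

definition row :: "nat list \<Rightarrow> bool list \<Rightarrow> nat \<Rightarrow> bool list" where
  "row d u i = map2 (\<lambda>a b. a = i \<and> b) d u"

definition planted :: "nat \<Rightarrow> nat \<Rightarrow> nat \<Rightarrow> bool \<times> bool \<Rightarrow> nat list \<Rightarrow> bool list \<Rightarrow> input" where
  "planted k n m v d u = plant k m (fst v) (snd v) (base_input k n d u)"

lemma planted_nth:
  assumes "i < k" "length d = n" "length u = n"
  shows "planted k n m v d u ! i = (row d u i)[m := (if i < k div 2 then fst v else snd v)]"
proof -
  have "map (\<lambda>l. d ! l = i \<and> u ! l) [0..<n] = row d u i"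
    using assms by (intro nth_equalityI) (auto simp: row_def)
  then show ?thesis using assms by (simp add: planted_def plant_def base_input_def)
qed

lemma expectation_bind_pmf_of_set:
  fixes h :: "'b \<Rightarrow> real"
  assumes "finite A" "A \<noteq> {}" "\<And>x. x \<in> A \<Longrightarrow> finite (set_pmf (f x))"
  shows "measure_pmf.expectation (bind_pmf (pmf_of_set A) f) h = avg A (\<lambda>x. measure_pmf.expectation (f x) h)"
  using assms by (subst pmf_expectation_bind_pmf_of_set) (auto simp: avg_def divide_inverse sum_distrib_left mult.commute)

lemma avg_bool_pair: "avg UNIV (\<lambda>x. avg UNIV (\<lambda>y. g x y)) = avg UNIV (\<lambda>v. g (fst v) (snd v))"
  for g :: "bool \<Rightarrow> bool \<Rightarrow> real"
  by (simp add: avg_def sum_divide_distrib[symmetric] sum.cartesian_product card_cartesian_product split_beta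
      flip: UNIV_Times_UNIV)

lemma execution_alt:
  assumes "k > 0" "n > 0"
  shows "execution k n coins P =
    bind_pmf (pmf_of_set (words {..<k} n)) (\<lambda>d. bind_pmf (pmf_of_set (words UNIV n)) (\<lambda>u.
    bind_pmf (pmf_of_set {..<n}) (\<lambda>m. bind_pmf (pmf_of_set UNIV) (\<lambda>x. bind_pmf (pmf_of_set UNIV) (\<lambda>y.
    map_pmf (\<lambda>t. (planted k n m (x, y) d u, d, m, t)) (transcript_pmf k coins P (planted k n m (x, y) d u)))))))"
proof -
  have "{..<k} \<noteq> {}" using assms by auto
  then show ?thesis
    by (simp add: execution_def psi_def bind_assoc_pmf bind_return_pmf replicate_pmf_of_set
        bernoulli_pmf_half_conv_pmf_of_set planted_def transcript_pmf_def map_pmf_def)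
qed

lemma finite_set_execution:
  assumes "k > 0" "n > 0"
  shows "finite (set_pmf (execution k n coins P))"
proof -
  have ne: "words {..<k} n \<noteq> {}" using assms by (intro words_nonempty) auto
  have "finite (set_pmf (transcript_pmf k coins P B))" for B
    by (rule finite_subset[OF set_transcript_pmf finite_leaves])
  then show ?thesis
    using assms by (simp add: execution_alt finite_words words_nonempty ne lessThan_empty_iff)
qed

text \<open>The average over \<open>u\<close> is innermost, so that fixing outer variables
  conditions on \<open>D\<close>, \<open>M\<close> and the planted pair.\<close>

lemma expectation_execution:
  fixes h :: "outcome \<Rightarrow> real"
  assumes "k > 0" "n > 0"
  shows "measure_pmf.expectation (execution k n coins P) h =
    avg (words {..<k} n) (\<lambda>d. avg {..<n} (\<lambda>m. avg UNIV (\<lambda>v. avg (words UNIV n) (\<lambda>u.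
      \<Sum>t\<in>leaves P. pmf (transcript_pmf k coins P (planted k n m v d u)) t * h (planted k n m v d u, d, m, t)))))"
proof -
  have ne: "words {..<k} n \<noteq> {}" "words (UNIV :: bool set) n \<noteq> {}" "{..<n} \<noteq> {}"
    using assms by (auto intro!: words_nonempty)
  have fin: "finite (words {..<k} n)" "finite (words (UNIV :: bool set) n)"
    by (simp_all add: finite_words)
  have finK: "finite (set_pmf (transcript_pmf k coins P B))" for B
    by (rule finite_subset[OF set_transcript_pmf finite_leaves])
  have K: "measure_pmf.expectation (map_pmf (\<lambda>t. (B, d, m, t)) (transcript_pmf k coins P B)) h =
    (\<Sum>t\<in>leaves P. pmf (transcript_pmf k coins P B) t * h (B, d, m, t))" for B d m
    using set_transcript_pmf[of k coins P B]
    by (subst integral_map_pmf, subst integral_measure_pmf_real[OF finite_leaves[of P]]) (auto simp: mult.commute)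
  show ?thesis
    unfolding execution_alt[OF assms]
    using ne fin finK
    by (simp add: expectation_bind_pmf_of_set K avg_bool_pair avg_swap[of "words UNIV n"] del: integral_map_pmf)
qed

lemma avg_delta: "finite S \<Longrightarrow> x \<in> S \<Longrightarrow> avg S (\<lambda>y. if y = x then g y else 0) = g x / card S"
  by (simp add: avg_def)

text \<open>The law of the transcript given \<open>D = d\<close> and \<open>M = m\<close>.\<close>

definition mix :: "nat \<Rightarrow> nat \<Rightarrow> (nat \<Rightarrow> nat pmf) \<Rightarrow> protocol \<Rightarrow> nat list \<Rightarrow> nat \<Rightarrow> bool list \<Rightarrow> real" where
  "mix k n coins P d m t =
    avg UNIV (\<lambda>v. avg (words UNIV n) (\<lambda>u. pmf (transcript_pmf k coins P (planted k n m v d u)) t))"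

lemma execution_bind_psi:
  "execution k n coins P =
    bind_pmf (psi k n) (\<lambda>z. map_pmf (\<lambda>t. (fst z, fst (snd z), snd (snd z), t)) (transcript_pmf k coins P (fst z)))"
  by (simp add: execution_def transcript_pmf_def map_pmf_def bind_assoc_pmf bind_return_pmf case_prod_unfold)

lemma pmf_execution:
  "pmf (execution k n coins P) (b, d, m, t) = pmf (psi k n) (b, d, m) * pmf (transcript_pmf k coins P b) t"
proof -
  have "pmf (map_pmf (\<lambda>t. (fst z, fst (snd z), snd (snd z), t)) (transcript_pmf k coins P (fst z))) (b, d, m, t) =
      indicator {(b, d, m)} z * pmf (transcript_pmf k coins P b) t" for z
  proof (cases "z = (b, d, m)")
    case True
    have "pmf (map_pmf (\<lambda>t. (b, d, m, t)) (transcript_pmf k coins P b)) (b, d, m, t) = pmf (transcript_pmf k coins P b) t"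
      by (rule pmf_map_inj') (auto simp: inj_on_def)
    then show ?thesis using True by simp
  next
    case False
    then have "(b, d, m, t) \<notin> set_pmf (map_pmf (\<lambda>t. (fst z, fst (snd z), snd (snd z), t)) (transcript_pmf k coins P (fst z)))"
      by (cases z) auto
    then show ?thesis using False by (simp add: pmf_eq_0_set_pmf)
  qed
  then show ?thesis
    by (simp add: execution_bind_psi pmf_bind measure_pmf_single)
qed

lemma map_execution_psi: "map_pmf (\<lambda>\<omega>. (B_of \<omega>, D_of \<omega>, M_of \<omega>)) (execution k n coins P) = psi k n"
  by (simp add: execution_bind_psi map_bind_pmf pmf.map_comp comp_def B_of_def D_of_def M_of_def bind_return_pmf')

lemma expectation_execution_delta:
  assumes "k > 0" "n > 0" "d \<in> words {..<k} n" "m < n"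
  shows "measure_pmf.expectation (execution k n coins P) (\<lambda>\<omega>. if D_of \<omega> = d \<and> M_of \<omega> = m then h (Pi_of \<omega>) else 0) =
    avg UNIV (\<lambda>v. avg (words UNIV n) (\<lambda>u. \<Sum>t\<in>leaves P. pmf (transcript_pmf k coins P (planted k n m v d u)) t * h t))
      / n / card (words {..<k} n)"
proof -
  let ?g = "\<lambda>d m. avg UNIV (\<lambda>v. avg (words UNIV n) (\<lambda>u. \<Sum>t\<in>leaves P. pmf (transcript_pmf k coins P (planted k n m v d u)) t * h t))"
  have "measure_pmf.expectation (execution k n coins P) (\<lambda>\<omega>. if D_of \<omega> = d \<and> M_of \<omega> = m then h (Pi_of \<omega>) else 0) =
     avg (words {..<k} n) (\<lambda>d'. if d' = d then avg {..<n} (\<lambda>m'. if m' = m then ?g d m' else 0) else 0)"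
    unfolding expectation_execution[OF assms(1,2)] D_of_def M_of_def Pi_of_def split_conv
    by (intro avg_cong) (auto simp: avg_const finite_words words_nonempty assms(2) lessThan_empty_iff intro!: avg_cong)
  also have "\<dots> = ?g d m / n / card (words {..<k} n)"
    using assms by (simp add: avg_delta finite_words)
  finally show ?thesis .
qed

text \<open>The transcript depends on \<open>(D, M)\<close> only through \<open>B\<close>, so the
  factor \<open>psi\<close> cancels in the logarithm. Its value, to which several \<open>u\<close>
  contribute, is never computed.\<close>

lemma info_cost_eq:
  assumes kn: "k > 0" "n > 0"
  shows "info_cost k n coins P =
    avg (words {..<k} n) (\<lambda>d. avg {..<n} (\<lambda>m. avg UNIV (\<lambda>v. avg (words UNIV n) (\<lambda>u.
      \<Sum>t\<in>leaves P. pmf (transcript_pmf k coins P (planted k n m v d u)) t *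
        log 2 (pmf (transcript_pmf k coins P (planted k n m v d u)) t / mix k n coins P d m t)))))"
proof -
  let ?E = "execution k n coins P"
  have prob_exp: "pmf (map_pmf g ?E) y = measure_pmf.expectation ?E (\<lambda>\<omega>. if g \<omega> = y then 1 else 0)" for g :: "outcome \<Rightarrow> 'z" and y
  proof -
    have "pmf (map_pmf g ?E) y = measure_pmf.expectation ?E (indicator (g -` {y}))"
      by (simp add: pmf_map)
    also have "\<dots> = measure_pmf.expectation ?E (\<lambda>\<omega>. if g \<omega> = y then 1 else 0)"
      by (intro Bochner_Integration.integral_cong) (auto simp: indicator_def)
    finally show ?thesis .
  qed
  have "info_cost k n coins P = measure_pmf.expectation ?E (\<lambda>\<omega>. log 2
      (pmf (map_pmf (\<lambda>\<omega>. (B_of \<omega>, Pi_of \<omega>, D_of \<omega>, M_of \<omega>)) ?E) (B_of \<omega>, Pi_of \<omega>, D_of \<omega>, M_of \<omega>) *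
        pmf (map_pmf (\<lambda>\<omega>. (D_of \<omega>, M_of \<omega>)) ?E) (D_of \<omega>, M_of \<omega>) /
       (pmf (map_pmf (\<lambda>\<omega>. (B_of \<omega>, D_of \<omega>, M_of \<omega>)) ?E) (B_of \<omega>, D_of \<omega>, M_of \<omega>) *
        pmf (map_pmf (\<lambda>\<omega>. (Pi_of \<omega>, D_of \<omega>, M_of \<omega>)) ?E) (Pi_of \<omega>, D_of \<omega>, M_of \<omega>))))"
    unfolding info_cost_def
    by (rule conditional_mutual_information_pmf) (simp_all add: finite_set_execution[OF kn])
  also have "\<dots> = measure_pmf.expectation ?E (\<lambda>\<omega>. log 2 (pmf (transcript_pmf k coins P (B_of \<omega>)) (Pi_of \<omega>) /
       mix k n coins P (D_of \<omega>) (M_of \<omega>) (Pi_of \<omega>)))"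
  proof (intro integral_cong_AE AE_pmfI)
    fix \<omega> assume \<omega>: "\<omega> \<in> set_pmf ?E"
    obtain b d m t where bdmt: "\<omega> = (b, d, m, t)" by (cases \<omega>)
    note sel = B_of_def D_of_def M_of_def Pi_of_def split_conv
    have "{..<k} \<noteq> {}" "{..<n} \<noteq> {}" using kn by auto
    then have dm: "d \<in> words {..<k} n" "m < n" and t: "t \<in> leaves P"
      using \<omega> unfolding execution_alt[OF kn] bdmt
      by (auto simp: finite_words words_nonempty dest: subsetD[OF set_transcript_pmf])
    have J: "pmf (map_pmf (\<lambda>\<omega>. (B_of \<omega>, Pi_of \<omega>, D_of \<omega>, M_of \<omega>)) ?E) (b, t, d, m) = pmf ?E (b, d, m, t)"
      using pmf_map_inj'[of "\<lambda>\<omega>. (B_of \<omega>, Pi_of \<omega>, D_of \<omega>, M_of \<omega>)" ?E "(b, d, m, t)"]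
      by (simp add: inj_on_def sel split_beta prod_eq_iff)
    have Z: "pmf (map_pmf (\<lambda>\<omega>. (D_of \<omega>, M_of \<omega>)) ?E) (d, m) = 1 / n / card (words {..<k} n)"
      using expectation_execution_delta[OF kn dm, of coins P "\<lambda>_. 1"]
      by (simp add: prob_exp sum_transcript_pmf avg_const finite_words words_nonempty)
    have YZ: "pmf (map_pmf (\<lambda>\<omega>. (Pi_of \<omega>, D_of \<omega>, M_of \<omega>)) ?E) (t, d, m) =
        mix k n coins P d m t / n / card (words {..<k} n)"
    proof -
      have "pmf (map_pmf (\<lambda>\<omega>. (Pi_of \<omega>, D_of \<omega>, M_of \<omega>)) ?E) (t, d, m) =
        measure_pmf.expectation ?E (\<lambda>\<omega>. if D_of \<omega> = d \<and> M_of \<omega> = m then (if Pi_of \<omega> = t then 1 else 0) else 0)"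
        unfolding prob_exp by (intro Bochner_Integration.integral_cong) auto
      also have "\<dots> = mix k n coins P d m t / n / card (words {..<k} n)"
        using expectation_execution_delta[OF kn dm, of coins P "\<lambda>s. if s = t then 1 else 0"]
        by (simp add: t finite_leaves mix_def mult_delta_right)
      finally show ?thesis .
    qed
    have "pmf ?E (b, d, m, t) > 0" using \<omega> by (intro pmf_positive) (simp add: bdmt)
    then have "pmf (psi k n) (b, d, m) \<noteq> 0" by (auto simp: pmf_execution)
    moreover have "card (words {..<k} n) \<noteq> 0" using kn by (simp add: card_words)
    ultimately show "log 2 (pmf (map_pmf (\<lambda>\<omega>. (B_of \<omega>, Pi_of \<omega>, D_of \<omega>, M_of \<omega>)) ?E) (B_of \<omega>, Pi_of \<omega>, D_of \<omega>, M_of \<omega>) *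
        pmf (map_pmf (\<lambda>\<omega>. (D_of \<omega>, M_of \<omega>)) ?E) (D_of \<omega>, M_of \<omega>) /
       (pmf (map_pmf (\<lambda>\<omega>. (B_of \<omega>, D_of \<omega>, M_of \<omega>)) ?E) (B_of \<omega>, D_of \<omega>, M_of \<omega>) *
        pmf (map_pmf (\<lambda>\<omega>. (Pi_of \<omega>, D_of \<omega>, M_of \<omega>)) ?E) (Pi_of \<omega>, D_of \<omega>, M_of \<omega>))) =
       log 2 (pmf (transcript_pmf k coins P (B_of \<omega>)) (Pi_of \<omega>) / mix k n coins P (D_of \<omega>) (M_of \<omega>) (Pi_of \<omega>))"
      using kn unfolding map_execution_psi
      by (simp add: bdmt B_of_def D_of_def M_of_def Pi_of_def J[unfolded sel] Z[unfolded sel] YZ[unfolded sel] pmf_execution)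
  qed auto
  also have "\<dots> = avg (words {..<k} n) (\<lambda>d. avg {..<n} (\<lambda>m. avg UNIV (\<lambda>v. avg (words UNIV n) (\<lambda>u.
      \<Sum>t\<in>leaves P. pmf (transcript_pmf k coins P (planted k n m v d u)) t *
        log 2 (pmf (transcript_pmf k coins P (planted k n m v d u)) t / mix k n coins P d m t)))))"
    unfolding expectation_execution[OF kn] by (simp add: B_of_def D_of_def M_of_def Pi_of_def)
  finally show ?thesis .
qed

text \<open>For \<open>k \<ge> 2\<close> both halves are nonempty, so the planted pair can be read
  off as \<open>(X, Y)\<close>; an empty half would always give the value 1.\<close>

lemma success_prob_eq:
  assumes k: "k \<ge> 2" and n: "n > 0"
  shows "success_prob k n coins P g =
    avg (words {..<k} n) (\<lambda>d. avg {..<n} (\<lambda>m. avg UNIV (\<lambda>v. avg (words UNIV n) (\<lambda>u.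
      \<Sum>t\<in>leaves P. pmf (transcript_pmf k coins P (planted k n m v d u)) t * of_bool (g t d m = v)))))"
proof -
  let ?E = "execution k n coins P"
  have XY: "XY_of k (planted k n m v d u, d, m, t) = v"
    if "d \<in> words {..<k} n" "m < n" "u \<in> words UNIV n" for d m u v t
  proof -
    have len: "length d = n" "length u = n" using that by (auto simp: words_def)
    have nth: "planted k n m v d u ! i ! m = (if i < k div 2 then fst v else snd v)" if "i < k" for i
      using that len \<open>m < n\<close> by (simp add: planted_nth row_def)
    have "X_val k (planted k n m v d u) m = fst v"
      unfolding X_val_def using nth k by (auto intro!: exI[of _ 0])
    moreover have "Y_val k (planted k n m v d u) m = snd v"
      unfolding Y_val_def using nth k by (auto intro!: bexI[of _ "k div 2"])
    ultimately show ?thesis by (simp add: XY_of_def B_of_def M_of_def)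
  qed
  have "success_prob k n coins P g =
      measure_pmf.expectation ?E (\<lambda>\<omega>. of_bool (g (Pi_of \<omega>) (D_of \<omega>) (M_of \<omega>) = XY_of k \<omega>))"
  proof -
    have "success_prob k n coins P g = measure_pmf.expectation ?E (indicator {\<omega>. g (Pi_of \<omega>) (D_of \<omega>) (M_of \<omega>) = XY_of k \<omega>})"
      by (simp add: success_prob_def)
    also have "\<dots> = measure_pmf.expectation ?E (\<lambda>\<omega>. of_bool (g (Pi_of \<omega>) (D_of \<omega>) (M_of \<omega>) = XY_of k \<omega>))"
      by (intro Bochner_Integration.integral_cong) (auto simp: indicator_def)
    finally show ?thesis .
  qed
  also have "\<dots> = avg (words {..<k} n) (\<lambda>d. avg {..<n} (\<lambda>m. avg UNIV (\<lambda>v. avg (words UNIV n) (\<lambda>u.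
      \<Sum>t\<in>leaves P. pmf (transcript_pmf k coins P (planted k n m v d u)) t * of_bool (g t d m = v)))))"
    using k n by (subst expectation_execution) (auto intro!: avg_cong sum.cong simp: XY D_of_def M_of_def Pi_of_def)
  finally show ?thesis .
qed

subsection \<open>The lower bound\<close>

lemma hell_commute: "hell T f g = hell T g f"
  unfolding hell_def by (intro sum.cong refl) (simp add: power2_commute)

lemma avg_UNIV_bool_pair_ge:
  assumes "\<And>v. g v \<ge> 0"
  shows "avg (UNIV :: (bool \<times> bool) set) g \<ge> g v / 4"
proof -
  have "g v \<le> (\<Sum>v\<in>UNIV. g v)" using assms by (intro member_le_sum) auto
  then show ?thesis by (simp add: avg_def)
qed

text \<open>If the law of the transcript ignores the planted pair, any guess is right for exactly
  one of the four pairs. This is the baseline from which advantages are measured.\<close>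

lemma avg_guess:
  assumes "(\<Sum>t\<in>T. f t) = 1"
  shows "avg (UNIV :: (bool \<times> bool) set) (\<lambda>v. \<Sum>t\<in>T. f t * of_bool (w t = v)) = 1 / 4"
proof -
  have eq: "avg (UNIV :: (bool \<times> bool) set) (\<lambda>v. f t * of_bool (w t = v)) = f t / 4" for t
    by (simp add: avg_def)
  show ?thesis unfolding avg_sum eq sum_divide_distrib[symmetric] assms by simp
qed

text \<open>Signs of distinct coordinates are uncorrelated, so only the \<open>n\<close> diagonal
  terms survive.\<close>

lemma avg_words_sign_sum_square:
  fixes \<sigma> :: "bool \<Rightarrow> real"
  defines "\<sigma> \<equiv> \<lambda>b. if b then - 1 else 1"
  shows "avg (words UNIV n) (\<lambda>u. (\<Sum>m<n. \<sigma> (u ! m))\<^sup>2) = real n"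
proof -
  have len: "length u = n" if "u \<in> words UNIV n" for u :: "bool list" using that by (simp add: words_def)
  have "avg (words UNIV n) (\<lambda>u. \<sigma> (u ! a) * \<sigma> (u ! b)) = (if a = b then 1 else 0)" if "a < n" "b < n" for a b
  proof (cases "a = b")
    case True
    then show ?thesis by (simp add: \<sigma>_def avg_const finite_words words_nonempty if_distrib cong: if_cong)
  next
    case False
    have "avg (words UNIV n) (\<lambda>u. \<sigma> (u ! a) * \<sigma> (u ! b)) =
        avg (words UNIV n) (\<lambda>u. avg UNIV (\<lambda>c. \<sigma> (u[a := c] ! a) * \<sigma> (u[a := c] ! b)))"
      using that by (intro avg_words_update) auto
    also have "\<dots> = avg (words UNIV n) (\<lambda>u :: bool list. 0)"
      using that False len by (intro avg_cong) (auto simp: avg_UNIV_bool \<sigma>_def)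
    finally show ?thesis using False by (simp add: avg_const finite_words words_nonempty)
  qed
  then have "(\<Sum>a<n. \<Sum>b<n. avg (words UNIV n) (\<lambda>u. \<sigma> (u ! a) * \<sigma> (u ! b))) = (\<Sum>a<n. \<Sum>b<n. if a = b then 1 else 0)"
    by (intro sum.cong refl) auto
  then show ?thesis by (simp add: power2_eq_square sum_product avg_sum)
qed

text \<open>Zeroing a random coordinate reweights \<open>u\<close> by \<open>1 + (\<Sum>m<n. \<sigma> (u ! m)) / n\<close>, and the
  sum of signs has standard deviation \<open>sqrt n\<close>.\<close>

lemma sum_avg_words_zeroed_ge:
  assumes "\<And>u. 0 \<le> S u" "\<And>u. S u \<le> 1"
  shows "(\<Sum>m<n. avg (words UNIV n) (\<lambda>u. S (u[m := False]))) \<ge> n * avg (words UNIV n) S - sqrt n"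
proof (cases "n = 0")
  case False
  define \<sigma> :: "bool \<Rightarrow> real" where "\<sigma> = (\<lambda>b. if b then - 1 else 1)"
  define R where "R u = (\<Sum>m<n. \<sigma> (u ! m))" for u
  have s: "sqrt n > 0" using False by simp
  have len: "length u = n" if "u \<in> words UNIV n" for u :: "bool list" using that by (simp add: words_def)
  \<comment> \<open>The weight \<open>1 + \<sigma> b\<close> is 2 at \<open>False\<close> and 0 at
    \<open>True\<close>, so the average over \<open>b\<close> becomes evaluation at
    \<open>False\<close>.\<close>
  have "avg (words UNIV n) (\<lambda>u. S (u[m := False])) = avg (words UNIV n) (\<lambda>u. S u + S u * \<sigma> (u ! m))" if "m < n" for m
  proof -
    have "avg (words UNIV n) (\<lambda>u. S u + S u * \<sigma> (u ! m)) =
       avg (words UNIV n) (\<lambda>u. avg UNIV (\<lambda>b. S (u[m := b]) + S (u[m := b]) * \<sigma> (u[m := b] ! m)))"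
      using that by (intro avg_words_update) auto
    also have "\<dots> = avg (words UNIV n) (\<lambda>u. S (u[m := False]))"
      using that len by (intro avg_cong) (auto simp: avg_UNIV_bool \<sigma>_def)
    finally show ?thesis by simp
  qed
  then have "(\<Sum>m<n. avg (words UNIV n) (\<lambda>u. S (u[m := False]))) =
      (\<Sum>m<n. avg (words UNIV n) (\<lambda>u. S u + S u * \<sigma> (u ! m)))"
    by simp
  also have "\<dots> = n * avg (words UNIV n) S + avg (words UNIV n) (\<lambda>u. S u * R u)"
    by (simp add: avg_sum[symmetric] sum.distrib R_def sum_distrib_left[symmetric] avg_add avg_cmult)
  finally have total: "(\<Sum>m<n. avg (words UNIV n) (\<lambda>u. S (u[m := False]))) =
      n * avg (words UNIV n) S + avg (words UNIV n) (\<lambda>u. S u * R u)" .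
  \<comment> \<open>AM-GM in place of Cauchy-Schwarz; the weight \<open>sqrt n\<close> balances the
    two terms once the second moment of \<open>R\<close> is inserted.\<close>
  have "avg (words UNIV n) (\<lambda>u. S u * R u) \<ge> avg (words UNIV n) (\<lambda>u. - ((R u)\<^sup>2 / sqrt n + sqrt n) / 2)"
  proof (rule avg_mono)
    fix u
    have "0 \<le> (\<bar>R u\<bar> - sqrt n)\<^sup>2" by simp
    then have "2 * \<bar>R u\<bar> * sqrt n \<le> (R u)\<^sup>2 + n" by (simp add: power2_diff)
    then have "2 * \<bar>R u\<bar> \<le> ((R u)\<^sup>2 + n) / sqrt n" using s by (simp add: pos_le_divide_eq)
    then have "2 * \<bar>R u\<bar> \<le> (R u)\<^sup>2 / sqrt n + sqrt n" by (simp add: add_divide_distrib real_div_sqrt)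
    moreover have "\<bar>S u * R u\<bar> \<le> \<bar>R u\<bar>"
      using assms[of u] mult_right_mono[of "S u" 1 "\<bar>R u\<bar>"] by (simp add: abs_mult)
    moreover have "- y / 2 \<le> x" if "2 * a \<le> y" "\<bar>x\<bar> \<le> a" for a x y :: real
      using that by linarith
    ultimately show "- ((R u)\<^sup>2 / sqrt n + sqrt n) / 2 \<le> S u * R u" by blast
  qed
  then have "avg (words UNIV n) (\<lambda>u. S u * R u) \<ge> - (avg (words UNIV n) (\<lambda>u. (R u)\<^sup>2) / sqrt n + sqrt n) / 2"
    unfolding avg_divide minus_divide_left
    by (simp add: avg_divide avg_diff avg_add avg_const finite_words words_nonempty avg_cmult[of _ "-1", simplified])
  moreover have "avg (words UNIV n) (\<lambda>u. (R u)\<^sup>2) / sqrt n = sqrt n"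
    unfolding R_def \<sigma>_def avg_words_sign_sum_square by (simp add: real_div_sqrt)
  ultimately have "avg (words UNIV n) (\<lambda>u. S u * R u) \<ge> - (sqrt n + sqrt n) / 2" by simp
  then have "avg (words UNIV n) (\<lambda>u. S u * R u) \<ge> - sqrt n" by simp
  with total show ?thesis by linarith
qed simp

lemma row_update:
  assumes "length d = length u"
  shows "row d (u[l := b]) i = (row d u i)[l := (d ! l = i \<and> b)]"
    and "row (d[l := a]) u i = (row d u i)[l := (a = i \<and> u ! l)]"
  using assms by (cases "l < length u"; auto intro!: nth_equalityI simp: row_def nth_list_update)+

section \<open>Setting, and a bound that does not grow with \<open>n\<close>\<close>

locale guess_protocol =
  fixes k n :: nat and coins :: "nat \<Rightarrow> nat pmf" and P :: protocol and g :: predictor and j :: nat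
  assumes k: "k = 2 ^ j" and j: "j \<ge> 1" and n: "n \<ge> 1" and speakers: "speakers P \<subseteq> {..<k}"
begin

abbreviation "W \<equiv> words {..<k} n"
abbreviation "U \<equiv> words (UNIV :: bool set) n"
abbreviation "V \<equiv> (UNIV :: (bool \<times> bool) set)"
abbreviation "T \<equiv> leaves P"

definition lik :: "nat \<Rightarrow> nat list \<Rightarrow> bool \<times> bool \<Rightarrow> bool list \<Rightarrow> bool list \<Rightarrow> real" where
  "lik m d v u t = pmf (transcript_pmf k coins P (planted k n m v d u)) t"

text \<open>The information about \<open>B\<close> given \<open>D = d\<close> and
  \<open>M = m\<close>, in nats.\<close>

definition info_at :: "nat list \<Rightarrow> nat \<Rightarrow> real" where
  "info_at d m = avg V (\<lambda>v. avg U (\<lambda>u. \<Sum>t\<in>T. lik m d v u t * ln (lik m d v u t / avg V (\<lambda>v. avg U (\<lambda>u. lik m d v u t)))))"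

lemma k2: "k \<ge> 2"
  using self_le_power[of 2 j] j k by simp

lemma finite_sets: "finite W" "finite U" "W \<noteq> {}" "U \<noteq> {}"
  using k2 by (auto intro!: finite_words words_nonempty simp: lessThan_empty_iff)

lemma lik_nonneg: "lik m d v u t \<ge> 0"
  by (simp add: lik_def)

lemma sum_lik: "(\<Sum>t\<in>T. lik m d v u t) = 1"
  by (simp add: lik_def sum_transcript_pmf)

lemma info_at_ge_hell: "info_at d m \<ge> avg V (\<lambda>v. hell T (\<lambda>t. avg U (\<lambda>u. lik m d v u t)) (\<lambda>t. avg V (\<lambda>v. avg U (\<lambda>u. lik m d v u t))))"
  unfolding info_at_def
  by (rule information_chain_bounds(1)) (simp_all add: finite_sets lik_nonneg sum_lik)

text \<open>Only the information about \<open>u\<close> given one planted pair is kept, an event of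
  conditional probability 1/4.\<close>

lemma info_at_ge_zero_part:
  "info_at d m \<ge> (\<Sum>t\<in>T. avg U (\<lambda>u. lik m d v u t * ln (lik m d v u t / avg U (\<lambda>u. lik m d v u t)))) / 4"
proof -
  have "info_at d m \<ge> avg V (\<lambda>v. \<Sum>t\<in>T. avg U (\<lambda>u. lik m d v u t * ln (lik m d v u t / avg U (\<lambda>u. lik m d v u t))))"
    unfolding info_at_def
    by (rule information_chain_bounds(2)) (simp_all add: finite_sets lik_nonneg sum_lik)
  moreover have "avg V (\<lambda>v. \<Sum>t\<in>T. avg U (\<lambda>u. lik m d v u t * ln (lik m d v u t / avg U (\<lambda>u. lik m d v u t)))) \<ge>
     (\<Sum>t\<in>T. avg U (\<lambda>u. lik m d v u t * ln (lik m d v u t / avg U (\<lambda>u. lik m d v u t)))) / 4"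
    by (rule avg_UNIV_bool_pair_ge, rule information_chain_bounds(3)[of V U]) (simp_all add: finite_sets lik_nonneg sum_lik)
  ultimately show ?thesis by linarith
qed

lemma info_at_nonneg: "info_at d m \<ge> 0"
  by (rule order.trans[OF avg_nonneg info_at_ge_hell]) (rule hell_nonneg)

text \<open>Passing from bits to nats multiplies by \<open>ln 2 \<le> 1\<close>, which only weakens
  a lower bound.\<close>

lemma info_cost_ge: "info_cost k n coins P \<ge> avg W (\<lambda>d. avg {..<n} (\<lambda>m. info_at d m))"
proof -
  have "info_cost k n coins P = avg W (\<lambda>d. avg {..<n} (\<lambda>m. info_at d m)) / ln 2"
    using k2 n
    by (subst info_cost_eq) (simp_all add: info_at_def[abs_def] lik_def mix_def log_def avg_divide sum_divide_distrib[symmetric])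
  moreover have "avg W (\<lambda>d. avg {..<n} (\<lambda>m. info_at d m)) \<ge> 0"
    by (intro avg_nonneg info_at_nonneg)
  moreover have "0 < ln (2::real)" "ln (2::real) \<le> 1" using ln_2_less_1 by auto
  ultimately show ?thesis
    by (simp add: pos_le_divide_eq mult_left_le)
qed

lemma success_prob_eq_lik:
  "success_prob k n coins P g =
     avg W (\<lambda>d. avg {..<n} (\<lambda>m. avg V (\<lambda>v. avg U (\<lambda>u. \<Sum>t\<in>T. lik m d v u t * of_bool (g t d m = v)))))"
  using k2 n unfolding lik_def by (subst success_prob_eq) auto

text \<open>The laws given the planted pair are compared with their mixture \<open>F\<close>, under
  which every guess succeeds with probability 1/4. With \<open>lam = c\<close>, the averaged
  information I satisfies \<open>2 * c \<le> c + I / c\<close>.\<close>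

lemma info_cost_ge_square:
  fixes c :: real
  assumes c: "c > 0" and succ: "success_prob k n coins P g \<ge> 1 / 4 + c"
  shows "info_cost k n coins P \<ge> c\<^sup>2"
proof -
  have "2 * (avg V (\<lambda>v. avg U (\<lambda>u. \<Sum>t\<in>T. lik m d v u t * of_bool (g t d m = v))) - 1 / 4) \<le> c + info_at d m / c" for d m
  proof -
    define f where "f v t = avg U (\<lambda>u. lik m d v u t)" for v t
    define F where "F t = avg V (\<lambda>v. f v t)" for t
    have f0: "f v t \<ge> 0" for v t unfolding f_def by (intro avg_nonneg lik_nonneg)
    have F0: "F t \<ge> 0" for t unfolding F_def by (intro avg_nonneg f0)
    have f1: "(\<Sum>t\<in>T. f v t) = 1" for v
      unfolding f_def avg_sum[symmetric] by (simp add: sum_lik avg_const finite_sets)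
    have F1: "(\<Sum>t\<in>T. F t) = 1"
      unfolding F_def avg_sum[symmetric] by (simp add: f1 avg_const)
    have "avg V (\<lambda>v. avg U (\<lambda>u. \<Sum>t\<in>T. lik m d v u t * of_bool (g t d m = v))) - 1 / 4 =
        avg V (\<lambda>v. \<Sum>t\<in>T. f v t * of_bool (g t d m = v)) - avg V (\<lambda>v. \<Sum>t\<in>T. F t * of_bool (g t d m = v))"
      by (simp only: avg_guess[OF F1] avg_sum[of U] avg_multc f_def)
    also have "\<dots> = avg V (\<lambda>v. \<Sum>t\<in>T. (f v t - F t) * of_bool (g t d m = v))"
      by (simp only: avg_diff[symmetric] sum_subtractf[symmetric] left_diff_distrib)
    finally have "2 * (avg V (\<lambda>v. avg U (\<lambda>u. \<Sum>t\<in>T. lik m d v u t * of_bool (g t d m = v))) - 1 / 4) =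
        avg V (\<lambda>v. 2 * (\<Sum>t\<in>T. (f v t - F t) * of_bool (g t d m = v)))"
      by (simp only: avg_cmult)
    also have "\<dots> \<le> avg V (\<lambda>v. c + hell T (f v) F / c)"
      by (intro avg_mono distinguish_le_hell) (simp_all add: f0 F0 f1 F1 c)
    also have "\<dots> = c + avg V (\<lambda>v. hell T (f v) F) / c"
      by (simp add: avg_add avg_divide avg_const)
    also have "\<dots> \<le> c + info_at d m / c"
      using info_at_ge_hell[of m d] c by (simp add: f_def[abs_def] F_def[abs_def] divide_right_mono)
    finally show ?thesis .
  qed
  then have "avg W (\<lambda>d. avg {..<n} (\<lambda>m. 2 * (avg V (\<lambda>v. avg U (\<lambda>u. \<Sum>t\<in>T. lik m d v u t * of_bool (g t d m = v))) - 1 / 4))) \<le>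
     avg W (\<lambda>d. avg {..<n} (\<lambda>m. c + info_at d m / c))"
    by (intro avg_mono)
  moreover have "{..<n} \<noteq> {}" using n by (auto simp: lessThan_empty_iff)
  ultimately have "2 * (success_prob k n coins P g - 1 / 4) \<le> c + avg W (\<lambda>d. avg {..<n} (\<lambda>m. info_at d m)) / c"
    unfolding success_prob_eq_lik
    by (simp only: avg_cmult avg_diff avg_add avg_divide) (simp add: avg_const finite_sets)
  moreover have "2 * c \<le> 2 * (success_prob k n coins P g - 1 / 4)" using succ by simp
  ultimately have "2 * c \<le> c + avg W (\<lambda>d. avg {..<n} (\<lambda>m. info_at d m)) / c" by (rule order.trans[rotated])
  then have "c\<^sup>2 \<le> avg W (\<lambda>d. avg {..<n} (\<lambda>m. info_at d m))" using c by (simp add: field_simps power2_eq_square)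
  then show ?thesis using info_cost_ge by linarith
qed

section \<open>Transcript laws with one coordinate set to zero\<close>

text \<open>The law of the transcript when coordinate \<open>m\<close> is all zero, site \<open>i\<close> has bit \<open>i \<in> A\<close> in coordinate
  \<open>l\<close>, and the other coordinates are unplanted with owners \<open>d\<close>.\<close>

definition zeroed_law :: "nat \<Rightarrow> nat \<Rightarrow> nat list \<Rightarrow> nat set \<Rightarrow> bool list \<Rightarrow> real" where
  "zeroed_law l m d A t = avg U (\<lambda>u. \<Prod>i<k. weight coins P i t ((row d u i)[m := False, l := (i \<in> A)]))"

text \<open>Always empty, one half or all of the sites; when nonempty its size is a power of two, as
  \<open>hell_product_le_sum\<close> requires.\<close>

definition ones :: "bool \<times> bool \<Rightarrow> nat set" where
  "ones v = {i. i < k \<and> (if i < k div 2 then fst v else snd v)}"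

lemma lik_eq:
  assumes "d \<in> W" "u \<in> U"
  shows "lik m d v u t = (\<Prod>i<k. weight coins P i t ((row d u i)[m := (i \<in> ones v)]))"
proof -
  have "length d = n" "length u = n" using assms by (auto simp: words_def)
  then show ?thesis
    using k2 speakers by (simp add: lik_def pmf_transcript_pmf planted_nth ones_def)
qed

lemma update_in_U: "u \<in> U \<Longrightarrow> u[l := b] \<in> U"
  by (simp add: words_def)

lemma zeroed_law_nonneg: "zeroed_law l m d A t \<ge> 0"
  unfolding zeroed_law_def by (intro avg_nonneg prod_nonneg) (simp add: weight_def)

lemma sum_zeroed_law: "(\<Sum>t\<in>T. zeroed_law l m d A t) = 1"
proof -
  have "(\<Sum>t\<in>T. \<Prod>i<k. weight coins P i t (r i)) = 1" for r
  proof -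
    have "(\<Sum>t\<in>T. \<Prod>i<k. weight coins P i t (r i)) = (\<Sum>t\<in>T. pmf (transcript_pmf k coins P (map r [0..<k])) t)"
      using k2 speakers by (simp add: pmf_transcript_pmf)
    then show ?thesis by (simp add: sum_transcript_pmf)
  qed
  then show ?thesis unfolding zeroed_law_def avg_sum[symmetric] by (simp add: avg_const finite_sets)
qed

text \<open>Coordinate \<open>l\<close> is overwritten at every site, so its owner has no influence.
  This leaves the owner free to be averaged later.\<close>

lemma zeroed_law_update_owner:
  assumes "d \<in> W"
  shows "zeroed_law l m (d[l := a]) A t = zeroed_law l m d A t"
  unfolding zeroed_law_def
proof (intro avg_cong prod.cong refl arg_cong[where f = "weight coins P _ t"])
  fix u i assume "u \<in> U"
  then have "length d = length u" using assms by (auto simp: words_def)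
  then show "(row (d[l := a]) u i)[m := False, l := i \<in> A] = (row d u i)[m := False, l := i \<in> A]"
    by (cases "l = m") (simp_all add: row_update list_update_swap)
qed

text \<open>The situation \<open>M = m\<close>: the planted zeros blank coordinate \<open>m\<close>,
  and bit \<open>l\<close> shows only in the row of its owner.\<close>

lemma avg_lik_zero_eq_zeroed_law:
  assumes "d \<in> W" "l \<noteq> m"
  shows "avg U (\<lambda>u. lik m d (False, False) (u[l := b]) t) = zeroed_law l m d (if b then {d ! l} else {}) t"
  unfolding zeroed_law_def
proof (rule avg_cong)
  fix u assume u: "u \<in> U"
  then have len: "length d = length u" using assms by (auto simp: words_def)
  have "ones (False, False) = {}" by (auto simp: ones_def)
  moreover have "(row d (u[l := b]) i)[m := False] = (row d u i)[m := False, l := i \<in> (if b then {d ! l} else {})]" for i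
    using assms(2) len by (cases b) (auto simp: row_update list_update_swap eq_commute[of i])
  ultimately show "lik m d (False, False) (u[l := b]) t =
      (\<Prod>i<k. weight coins P i t ((row d u i)[m := False, l := i \<in> (if b then {d ! l} else {})]))"
    by (simp only: lik_eq[OF assms(1) update_in_U[OF u]]) simp
qed

text \<open>The situation \<open>M = l\<close>: the planted pair fills coordinate \<open>l\<close>,
  and the ordinary bit of coordinate \<open>m\<close> is blanked. Both situations thus share one
  family of laws.\<close>

lemma avg_lik_zeroed_eq_zeroed_law:
  assumes "d \<in> W"
  shows "avg U (\<lambda>u. lik l d v (u[m := False]) t) = zeroed_law l m d (ones v) t"
  unfolding zeroed_law_def
proof (rule avg_cong)
  fix u assume u: "u \<in> U"
  then have len: "length d = length u" using assms by (auto simp: words_def)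
  then show "lik l d v (u[m := False]) t = (\<Prod>i<k. weight coins P i t ((row d u i)[m := False, l := i \<in> ones v]))"
    by (simp add: lik_eq[OF assms(1) update_in_U[OF u]] row_update)
qed

text \<open>Given \<open>d\<close> the rows are independent, so averaging over \<open>u\<close>
  keeps the product form over sites and \<open>hell_product_le_sum\<close> applies. The sum over
  \<open>ones v\<close> is then extended to all sites.\<close>

lemma hell_zeroed_law_le:
  assumes d: "d \<in> W"
  shows "hell T (zeroed_law l m d {}) (zeroed_law l m d (ones v)) \<le> 4 * (\<Sum>i<k. hell T (zeroed_law l m d {}) (zeroed_law l m d {i}))"
proof -
  define H where "H i t b = avg U (\<lambda>u. weight coins P i t ((row d u i)[m := False, l := b]))" for i t b
  have "length d = n" using d by (simp add: words_def)
  then have "zeroed_law l m d A t = (\<Prod>i<k. H i t (i \<in> A))" for A t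
    using avg_words_prod_rows[of "{..<k}" d "\<lambda>i r. weight coins P i t (r[m := False, l := (i \<in> A)])"]
    by (simp add: zeroed_law_def H_def row_def)
  then have zeroed_law: "zeroed_law l m d = (\<lambda>A t. \<Prod>i<k. H i t (i \<in> A))" by blast
  have H0: "H i t b \<ge> 0" for i t b unfolding H_def by (intro avg_nonneg) (simp add: weight_def)
  have sub: "hell T (zeroed_law l m d {}) (zeroed_law l m d X) \<le> 4 * (\<Sum>i<k. hell T (zeroed_law l m d {}) (zeroed_law l m d {i}))"
    if X: "X \<subseteq> {..<k}" "card X = 2 ^ e" for X e
  proof -
    have "hell T (zeroed_law l m d {}) (zeroed_law l m d X) \<le> 4 * (\<Sum>i\<in>X. hell T (zeroed_law l m d {}) (zeroed_law l m d {i}))"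
      unfolding zeroed_law by (rule hell_product_le_sum[where J = e]) (use X H0 sum_zeroed_law[of l m d] in \<open>simp_all add: zeroed_law\<close>)
    also have "(\<Sum>i\<in>X. hell T (zeroed_law l m d {}) (zeroed_law l m d {i})) \<le> (\<Sum>i<k. hell T (zeroed_law l m d {}) (zeroed_law l m d {i}))"
      using X by (intro sum_mono2 hell_nonneg) auto
    finally show ?thesis by simp
  qed
  have half: "k div 2 = 2 ^ (j - 1)" "k - k div 2 = 2 ^ (j - 1)"
    using k j by (cases j; simp)+
  obtain x y where v: "v = (x, y)" by (cases v)
  consider "ones v = {}" | "ones v = {..<k div 2}" | "ones v = {k div 2..<k}" | "ones v = {..<k}"
    unfolding ones_def v by (cases x; cases y) (fastforce split: if_splits)+
  then show ?thesis
  proof cases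
    case 1
    have "0 \<le> (\<Sum>i<k. hell T (zeroed_law l m d {}) (zeroed_law l m d {i}))" by (intro sum_nonneg hell_nonneg)
    then show ?thesis by (simp add: 1 hell_def)
  next
    case 2
    show ?thesis unfolding 2 by (rule sub[where e = "j - 1"], force) (simp add: half)
  next
    case 3
    show ?thesis unfolding 3 by (rule sub[where e = "j - 1"], force) (simp only: card_atLeastLessThan half(2))
  next
    case 4
    show ?thesis unfolding 4 by (rule sub[where e = j]) (auto simp: k)
  qed
qed

text \<open>\<open>gibbs_avg_words\<close> is applied at every transcript, with zeros planted in
  \<open>m\<close>. It costs a factor 4, and keeping a single planted pair another 4.\<close>

lemma info_at_ge_sum_hell:
  assumes d: "d \<in> W"
  shows "info_at d m \<ge> (\<Sum>l\<in>{..<n}-{m}. hell T (zeroed_law l m d {}) (zeroed_law l m d {d ! l})) / 16"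
proof -
  define \<nu> where "\<nu> l b t = avg U (\<lambda>u. lik m d (False, False) (u[l := b]) t)" for l b t
  have "(\<Sum>l\<in>{..<n}-{m}. hell T (zeroed_law l m d {}) (zeroed_law l m d {d ! l})) = (\<Sum>l\<in>{..<n}-{m}. hell T (\<nu> l False) (\<nu> l True))"
    using avg_lik_zero_eq_zeroed_law[OF d] by (intro sum.cong refl) (simp add: hell_def \<nu>_def)
  also have "\<dots> \<le> (\<Sum>l<n. hell T (\<nu> l False) (\<nu> l True))"
    by (intro sum_mono2 hell_nonneg) auto
  also have "\<dots> = 4 * (\<Sum>t\<in>T. (\<Sum>l<n. (sqrt (\<nu> l False t) - sqrt (\<nu> l True t))\<^sup>2) / 4)"
    unfolding hell_def by (subst sum.swap) (simp add: sum_divide_distrib[symmetric])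
  also have "\<dots> \<le> 4 * (\<Sum>t\<in>T. avg U (\<lambda>u. lik m d (False, False) u t *
      ln (lik m d (False, False) u t / avg U (\<lambda>u. lik m d (False, False) u t))))"
    unfolding \<nu>_def by (intro mult_left_mono sum_mono gibbs_avg_words lik_nonneg) simp
  also have "\<dots> \<le> 16 * info_at d m" using info_at_ge_zero_part[where d = d and m = m and v = "(False, False)"] by simp
  finally show ?thesis by simp
qed

text \<open>The owner of \<open>l\<close> is uniform and does not affect \<open>zeroed_law\<close>,
  so averaging over it gives \<open>1 / k\<close> times the sum over all sites. The 4 comes from
  \<open>hell_zeroed_law_le\<close>.\<close>

lemma avg_hell_zeroed_law_ge:
  assumes l: "l < n"
  shows "avg W (\<lambda>d. hell T (zeroed_law l m d {}) (zeroed_law l m d {d ! l})) \<ge>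
    avg W (\<lambda>d. avg V (\<lambda>v. hell T (zeroed_law l m d {}) (zeroed_law l m d (ones v)))) / (4 * k)"
proof -
  have "avg W (\<lambda>d. avg V (\<lambda>v. hell T (zeroed_law l m d {}) (zeroed_law l m d (ones v)))) / (4 * k) =
      avg W (\<lambda>d. avg V (\<lambda>v. hell T (zeroed_law l m d {}) (zeroed_law l m d (ones v))) / (4 * k))"
    by (simp add: avg_divide)
  also have "\<dots> \<le> avg W (\<lambda>d. avg {..<k} (\<lambda>i. hell T (zeroed_law l m d {}) (zeroed_law l m d {i})))"
  proof (rule avg_mono)
    fix d assume d: "d \<in> W"
    have "avg V (\<lambda>v. hell T (zeroed_law l m d {}) (zeroed_law l m d (ones v))) \<le>
        avg V (\<lambda>v. 4 * (\<Sum>i<k. hell T (zeroed_law l m d {}) (zeroed_law l m d {i})))"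
      using hell_zeroed_law_le[OF d] by (rule avg_mono)
    also have "\<dots> = 4 * k * avg {..<k} (\<lambda>i. hell T (zeroed_law l m d {}) (zeroed_law l m d {i}))"
      using k2 by (simp add: avg_const) (simp add: avg_def)
    finally show "avg V (\<lambda>v. hell T (zeroed_law l m d {}) (zeroed_law l m d (ones v))) / (4 * k) \<le>
        avg {..<k} (\<lambda>i. hell T (zeroed_law l m d {}) (zeroed_law l m d {i}))"
      using k2 by (simp add: field_simps)
  qed
  also have "\<dots> = avg W (\<lambda>d. avg {..<k} (\<lambda>a. hell T (zeroed_law l m (d[l := a]) {}) (zeroed_law l m (d[l := a]) {d[l := a] ! l})))"
  proof (intro avg_cong)
    fix d a assume d: "d \<in> W"
    then have "d[l := a] ! l = a" using l by (simp add: words_def)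
    then show "hell T (zeroed_law l m d {}) (zeroed_law l m d {a}) = hell T (zeroed_law l m (d[l := a]) {}) (zeroed_law l m (d[l := a]) {d[l := a] ! l})"
      by (simp add: hell_def zeroed_law_update_owner[OF d])
  qed
  also have "\<dots> = avg W (\<lambda>d. hell T (zeroed_law l m d {}) (zeroed_law l m d {d ! l}))"
    using l k2 by (intro avg_words_update[symmetric]) (auto simp: lessThan_empty_iff)
  finally show ?thesis .
qed

section \<open>Guessing after a coordinate has been set to zero\<close>

definition guess_prob :: "nat \<Rightarrow> nat list \<Rightarrow> bool list \<Rightarrow> real" where
  "guess_prob l d u = avg V (\<lambda>v. \<Sum>t\<in>T. lik l d v u t * of_bool (g t d l = v))"

definition zeroed_guess :: "nat \<Rightarrow> nat \<Rightarrow> real" where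
  "zeroed_guess l m = avg W (\<lambda>d. avg U (\<lambda>u. guess_prob l d (u[m := False])))"

lemma guess_prob_bounds: "0 \<le> guess_prob l d u" "guess_prob l d u \<le> 1"
proof -
  show "0 \<le> guess_prob l d u" unfolding guess_prob_def by (intro avg_nonneg sum_nonneg mult_nonneg_nonneg lik_nonneg) simp
  have "guess_prob l d u \<le> avg V (\<lambda>v. \<Sum>t\<in>T. lik l d v u t * 1)"
    unfolding guess_prob_def by (intro avg_mono sum_mono mult_left_mono lik_nonneg) simp
  then show "guess_prob l d u \<le> 1" by (simp add: sum_lik avg_const)
qed

lemma zeroed_guess_le_1: "zeroed_guess l m \<le> 1"
proof -
  have "zeroed_guess l m \<le> avg W (\<lambda>d. avg U (\<lambda>u. 1))" unfolding zeroed_guess_def by (intro avg_mono guess_prob_bounds)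
  then show ?thesis by (simp add: avg_const finite_sets)
qed

lemma sum_zeroed_guess_ge: "(\<Sum>l<n. \<Sum>m<n. zeroed_guess l m) \<ge> n * n * success_prob k n coins P g - n * sqrt n"
proof -
  have "success_prob k n coins P g = avg {..<n} (\<lambda>l. avg W (\<lambda>d. avg U (\<lambda>u. guess_prob l d u)))"
    unfolding success_prob_eq_lik guess_prob_def by (simp add: avg_swap[of W] avg_swap[of V U])
  then have "n * n * success_prob k n coins P g - n * sqrt n =
      (\<Sum>l<n. avg W (\<lambda>d. n * avg U (\<lambda>u. guess_prob l d u) - sqrt n))"
    using n by (simp add: avg_diff avg_cmult avg_const finite_sets sum_subtractf sum_distrib_left[symmetric])
      (simp add: avg_def)
  also have "\<dots> \<le> (\<Sum>l<n. avg W (\<lambda>d. \<Sum>m<n. avg U (\<lambda>u. guess_prob l d (u[m := False]))))"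
    by (intro sum_mono avg_mono sum_avg_words_zeroed_ge guess_prob_bounds)
  also have "\<dots> = (\<Sum>l<n. \<Sum>m<n. zeroed_guess l m)" by (simp add: avg_sum zeroed_guess_def)
  finally show ?thesis .
qed

text \<open>The law for \<open>{}\<close> does not depend on \<open>v\<close> and yields success
  1/4. With \<open>lam\<close> fixed the bound is linear in the advantage, so it can be summed over
  \<open>l\<close> and \<open>m\<close> even where the advantage is negative.\<close>

lemma hell_zeroed_law_ge_advantage:
  assumes lam: "lam > 0"
  shows "avg W (\<lambda>d. avg V (\<lambda>v. hell T (zeroed_law l m d {}) (zeroed_law l m d (ones v)))) \<ge> 2 * lam * (zeroed_guess l m - 1 / 4) - lam\<^sup>2"
proof -
  have "avg U (\<lambda>u. guess_prob l d (u[m := False])) = avg V (\<lambda>v. \<Sum>t\<in>T. zeroed_law l m d (ones v) t * of_bool (g t d l = v))"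
    if d: "d \<in> W" for d
    unfolding guess_prob_def avg_swap[of U] avg_sum[of U] avg_multc avg_lik_zeroed_eq_zeroed_law[OF d] ..
  then have "zeroed_guess l m = avg W (\<lambda>d. avg V (\<lambda>v. \<Sum>t\<in>T. zeroed_law l m d (ones v) t * of_bool (g t d l = v)))"
    unfolding zeroed_guess_def by (rule avg_cong)
  moreover have "1 / 4 = avg W (\<lambda>d. avg V (\<lambda>v. \<Sum>t\<in>T. zeroed_law l m d {} t * of_bool (g t d l = v)))"
    by (simp only: avg_guess[OF sum_zeroed_law] avg_const finite_sets not_False_eq_True)
  ultimately have "2 * (zeroed_guess l m - 1 / 4) =
     avg W (\<lambda>d. avg V (\<lambda>v. 2 * (\<Sum>t\<in>T. (zeroed_law l m d (ones v) t - zeroed_law l m d {} t) * of_bool (g t d l = v))))"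
    by (simp only: avg_cmult avg_diff left_diff_distrib sum_subtractf)
  also have "\<dots> \<le> avg W (\<lambda>d. avg V (\<lambda>v. lam + hell T (zeroed_law l m d (ones v)) (zeroed_law l m d {}) / lam))"
    by (intro avg_mono distinguish_le_hell) (simp_all add: zeroed_law_nonneg sum_zeroed_law lam)
  also have "\<dots> = lam + avg W (\<lambda>d. avg V (\<lambda>v. hell T (zeroed_law l m d {}) (zeroed_law l m d (ones v)))) / lam"
    by (simp add: avg_add avg_divide avg_const finite_sets hell_commute)
  finally show ?thesis using lam by (simp add: field_simps power2_eq_square)
qed

section \<open>The bound for large \<open>n\<close>\<close>

lemma info_cost_ge_large:
  fixes c :: real
  assumes c: "c > 0" and succ: "success_prob k n coins P g \<ge> 1 / 4 + c" and large: "sqrt n + 1 \<le> n * c / 2"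
  shows "info_cost k n coins P \<ge> c\<^sup>2 / 256 * (n / k)"
proof -
  \<comment> \<open>This maximises \<open>lam * c - lam\<^sup>2\<close>, where \<open>c / 2\<close>
    is the mean advantage secured by \<open>off\<close>.\<close>
  define lam where "lam = c / 2"
  have lam: "lam > 0" using c by (simp add: lam_def)
  define E where "E l m = avg W (\<lambda>d. avg V (\<lambda>v. hell T (zeroed_law l m d {}) (zeroed_law l m d (ones v))))" for l m
  \<comment> \<open>Of the total advantage \<open>n * n * c\<close>, zeroing costs at most
    \<open>n * sqrt n\<close> and dropping the diagonal at most \<open>n\<close>. By
    \<open>large\<close> half remains.\<close>
  have off: "(\<Sum>m<n. \<Sum>l\<in>{..<n}-{m}. zeroed_guess l m - 1 / 4) \<ge> n * n * c / 2"
  proof -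
    have "(\<Sum>m<n. \<Sum>l\<in>{..<n}-{m}. zeroed_guess l m - 1 / 4) = (\<Sum>m<n. (\<Sum>l<n. zeroed_guess l m - 1 / 4) - (zeroed_guess m m - 1 / 4))"
      by (intro sum.cong refl) (simp add: sum_diff1)
    also have "\<dots> = (\<Sum>m<n. \<Sum>l<n. zeroed_guess l m) - n * n / 4 - (\<Sum>m<n. zeroed_guess m m - 1 / 4)"
      by (simp add: sum_subtractf)
    also have "(\<Sum>m<n. \<Sum>l<n. zeroed_guess l m) = (\<Sum>l<n. \<Sum>m<n. zeroed_guess l m)" by (rule sum.swap)
    finally have "(\<Sum>m<n. \<Sum>l\<in>{..<n}-{m}. zeroed_guess l m - 1 / 4) =
        (\<Sum>l<n. \<Sum>m<n. zeroed_guess l m) - n * n / 4 - (\<Sum>m<n. zeroed_guess m m - 1 / 4)" .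
    moreover have "zeroed_guess m m - 1 / 4 \<le> 1" for m using zeroed_guess_le_1[of m m] by simp
    then have "(\<Sum>m<n. zeroed_guess m m - 1 / 4) \<le> (\<Sum>m<n. 1)" by (rule sum_mono)
    ultimately have "(\<Sum>m<n. \<Sum>l\<in>{..<n}-{m}. zeroed_guess l m - 1 / 4) \<ge> (\<Sum>l<n. \<Sum>m<n. zeroed_guess l m) - n * n / 4 - n" by simp
    moreover have "n * n * (1 / 4 + c) \<le> n * n * success_prob k n coins P g"
      using succ by (intro mult_left_mono) auto
    moreover have "n * (sqrt n + 1) \<le> n * (n * c / 2)" using large by (intro mult_left_mono) auto
    ultimately show ?thesis using sum_zeroed_guess_ge by (simp add: algebra_simps)
  qed
  have "n * n * c\<^sup>2 / 4 \<le> 2 * lam * (n * n * c / 2) - n * n * lam\<^sup>2"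
    by (simp add: lam_def power2_eq_square field_simps)
  also have "\<dots> \<le> 2 * lam * (\<Sum>m<n. \<Sum>l\<in>{..<n}-{m}. zeroed_guess l m - 1 / 4) - n * (n - 1) * lam\<^sup>2"
    using off lam n by (intro diff_mono mult_left_mono mult_right_mono) auto
  also have "\<dots> = (\<Sum>m<n. \<Sum>l\<in>{..<n}-{m}. 2 * lam * (zeroed_guess l m - 1 / 4) - lam\<^sup>2)"
  proof -
    have "2 * lam * (\<Sum>m<n. \<Sum>l\<in>{..<n}-{m}. a l m) - n * (n - 1) * lam\<^sup>2 =
        (\<Sum>m<n. \<Sum>l\<in>{..<n}-{m}. 2 * lam * a l m - lam\<^sup>2)" for a
      using n by (simp add: sum_subtractf sum_distrib_left)
    then show ?thesis .
  qed
  also have "\<dots> \<le> (\<Sum>m<n. \<Sum>l\<in>{..<n}-{m}. E l m)"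
    unfolding E_def by (intro sum_mono hell_zeroed_law_ge_advantage lam)
  finally have E: "n * n * c\<^sup>2 / 4 \<le> (\<Sum>m<n. \<Sum>l\<in>{..<n}-{m}. E l m)" .
  \<comment> \<open>Here 64 is the 4 of \<open>avg_hell_zeroed_law_ge\<close> times the 16 of
    \<open>info_at_ge_sum_hell\<close>; the last factor 4 of 256 comes from
    \<open>E\<close>.\<close>
  have "c\<^sup>2 / 256 * (n / k) = (n * n * c\<^sup>2 / 4) / (64 * k * n)"
    using n k2 by (simp add: field_simps)
  also have "\<dots> \<le> (\<Sum>m<n. \<Sum>l\<in>{..<n}-{m}. E l m) / (64 * k * n)"
    by (intro divide_right_mono E) simp
  also have "\<dots> = avg {..<n} (\<lambda>m. (\<Sum>l\<in>{..<n}-{m}. E l m / (4 * k)) / 16)"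
    unfolding avg_def by (simp add: sum_divide_distrib[symmetric])
  also have "\<dots> \<le> avg {..<n} (\<lambda>m. (\<Sum>l\<in>{..<n}-{m}. avg W (\<lambda>d. hell T (zeroed_law l m d {}) (zeroed_law l m d {d ! l}))) / 16)"
    unfolding E_def by (intro avg_mono divide_right_mono sum_mono avg_hell_zeroed_law_ge) auto
  also have "\<dots> = avg W (\<lambda>d. avg {..<n} (\<lambda>m. (\<Sum>l\<in>{..<n}-{m}. hell T (zeroed_law l m d {}) (zeroed_law l m d {d ! l})) / 16))"
    by (simp add: avg_swap[of W] avg_divide avg_sum)
  also have "\<dots> \<le> avg W (\<lambda>d. avg {..<n} (\<lambda>m. info_at d m))"
    by (intro avg_mono info_at_ge_sum_hell)
  finally show ?thesis using info_cost_ge by linarith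
qed

end

theorem theorem5:
  fixes c :: real
  assumes "c > 0"
  shows "\<exists>C>0. \<forall>k n coins P g.
           (\<exists>j\<ge>1. k = 2 ^ j) \<longrightarrow> n \<ge> 1 \<longrightarrow> speakers P \<subseteq> {..<k} \<longrightarrow>
           max_likelihood k n coins P g \<longrightarrow> success_prob k n coins P g \<ge> 1/4 + c \<longrightarrow>
           info_cost k n coins P \<ge> C * (real n / real k)"
proof (intro exI[of _ "c ^ 4 / 256"] conjI allI impI)
  \<comment> \<open>For \<open>n \<le> 16 / c\<^sup>2\<close> this constant makes the claimed bound
    at most \<open>c\<^sup>2 / 16\<close>. For larger \<open>n\<close> it is at most
    \<open>c\<^sup>2 / 256\<close>, because \<open>c \<le> 1\<close>.\<close>
  show "c ^ 4 / 256 > 0" using assms by simp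
  fix k n coins P g
  assume "\<exists>j\<ge>1. k = 2 ^ j" and n: "n \<ge> 1" and sp: "speakers P \<subseteq> {..<k}"
    and succ: "success_prob k n coins P g \<ge> 1 / 4 + c"
  then obtain j where j: "k = 2 ^ j" "j \<ge> 1" by blast
  have "success_prob k n coins P g \<le> 1" by (simp add: success_prob_def)
  then have c1: "c \<le> 1" using succ by linarith
  interpret guess_protocol k n coins P g j by standard (use j n sp in auto)
  show "info_cost k n coins P \<ge> c ^ 4 / 256 * (real n / real k)"
  \<comment> \<open>Beyond the threshold, \<open>4 * sqrt n \<le> n * c\<close>; with
    \<open>1 \<le> sqrt n\<close> this gives the size condition of
    \<open>info_cost_ge_large\<close>.\<close>
  proof (cases "n \<le> 16 / c\<^sup>2")
    case True
    have "real n / real k \<le> real n" using j mult_left_mono[of 1 "real k" "real n"] by (simp add: divide_le_eq)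
    then have "c ^ 4 / 256 * (real n / real k) \<le> c ^ 4 / 256 * (16 / c\<^sup>2)"
      using True by (intro mult_left_mono) auto
    also have "\<dots> = c\<^sup>2 / 16" using assms by (simp add: field_simps power2_eq_square power4_eq_xxxx)
    also have "\<dots> \<le> c\<^sup>2" by simp
    also have "\<dots> \<le> info_cost k n coins P"
      by (rule info_cost_ge_square[OF assms succ])
    finally show ?thesis .
  next
    case False
    then have big: "(4 / c)\<^sup>2 < n" by (simp add: power_divide)
    then have "4 / c \<le> sqrt n" by (intro real_le_rsqrt) simp
    then have r: "4 \<le> c * sqrt n" using assms by (simp add: field_simps)
    then have "4 * sqrt n \<le> c * sqrt n * sqrt n" by (intro mult_right_mono) auto
    then have "4 * sqrt n \<le> n * c" by (simp add: mult.commute mult.left_commute)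
    moreover have "4 \<le> 4 * sqrt n" using n by simp
    ultimately have "sqrt n + 1 \<le> n * c / 2" by linarith
    then have "c\<^sup>2 / 256 * (n / k) \<le> info_cost k n coins P"
      by (rule info_cost_ge_large[OF assms succ])
    moreover have "c ^ 4 / 256 * (real n / real k) \<le> c\<^sup>2 / 256 * (real n / real k)"
      using assms c1 by (intro mult_right_mono divide_right_mono power_decreasing) auto
    ultimately show ?thesis by linarith
  qed
qed

end
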